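(* Let $\Sigma$ be a connected and unbalanced signed graph. Let $U=\delta X^\nu=[X,X^c]\cup E_X\cup O_X$ be a cut of $\Sigma$. Then: (a) The removal of $U$ increases the number of balanced components, i.e. $b(\Sigma\setminus U)>b(\Sigma)$. (b) The cut $U$ is a bond if and only if $\Sigma[X]$ is connected and each component of $\Sigma[X^c)$ is unbalanced. (c) An edge subset $S$ of $\Sigma$ is a bond of $\Sigma$ if and only if $S$ is a minimal edge subset whose removal increases exactly one balanced component, that is, $$b(\Sigma\setminus S)=b(\Sigma)+1,\qquad b(\Sigma)=b((\Sigma\setminus S)\cup e)\ \text{ for every } e\in S.$$
   Context: A graph $(V,E)$ has finite vertex set $V$ and finite edge set $E$ (multiple edges allowed); each edge has two ends, each end is attached to one vertex or to none, and at least one end is attached to a vertex. A loop has both ends at the same vertex, a link has its ends at two distinct vertices, an outer-edge has exactly one end attached to a vertex. A signed graph $\Sigma=(V,E,\sigma)$ is a graph with a sign function $\sigma:E\to\{1,-1\}$. A circle is a connected 2-regular signed (sub)graph without outer-edges (a loop with its vertex is a circle); its sign is the product of its edge signs. A signed graph is balanced if it has no outer-edges and all its circles are positive; otherwise it is unbalanced. $b(\Sigma)$ is the number of balanced connected components of $\Sigma$ (isolated vertices are balanced components). $\Sigma\setminus S$ denotes deletion of the edges in $S$ (vertices are kept), and $(\Sigma\setminus S)\cup e=\Sigma\setminus(S\setminus\{e\})$ for $e\in S$. For $X\subseteq V$: $X^c=V\setminus X$; $O_X$ is the set of outer-edges with endpoint in $X$; $[X,X^c]$ is the set of links between $X$ and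 $X^c$; $\Sigma[X]$ is the signed subgraph with vertex set $X$ and all loops and links of $\Sigma$ having all endpoints in $X$; $\Sigma[X):=\Sigma[X]\cup O_X$ (so $\Sigma[X^c)$ is empty, without components, if $X=V$). A switching on $X$ is a function $\nu:V\to\{1,-1\}$ with $\nu(v)=1$ for $v\in X^c$. The switched signed graph $\Sigma^\nu$ has the same vertices and edges and sign $\sigma^\nu(e)=\nu(u)\sigma(e)\nu(v)$ for a loop or link $e=uv$, and $\sigma^\nu(e)=\nu(u)\sigma(e)$ for an outer-edge at $u$. Put $\delta X^\nu:=[X,X^c]\cup E_X\cup O_X$, where $E_X$ is the set of edges $e$ of $\Sigma[X]$ with $\sigma^\nu(e)=-1$. A cut of $\Sigma$ is a nonempty edge subset $U$ of the form $U=\delta X^\nu$, with $X$ nonempty and $\nu$ a switching on $X$, such that $\Sigma[X]\setminus U$ is balanced, the edges of $\Sigma[X]$ in $U$ are negative in $\Sigma^\nu$, the edges of $\Sigma[X]$ not in $U$ are positive in $\Sigma^\nu$, and $(\Sigma[X]\setminus U)\cup e$ is unbalanced for each edge $e$ of $\Sigma[X]$ belonging to $U$. A bond of $\Sigma$ is a cut $U$ such that no cut of $\Sigma$ is properly contained in $U$ as an edge subset. *)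

theory Defs
  imports Main
begin

text \<open>An edge has two ends, indexed by bool; each end is attached to a vertex or to nothing
  (None). The index only distinguishes the two ends: every notion below is invariant under
  swapping them, so edges are undirected. Parallel edges are distinct elements of the edge
  type. Attachment and signs are total functions, meaningful on the edge set only.\<close>

record ('v, 'e) sgraph =
  sg_verts :: "'v set"
  sg_edges :: "'e set"
  sg_attach :: "'e \<Rightarrow> bool \<Rightarrow> 'v option"
  sg_sign :: "'e \<Rightarrow> int"

definition signed_graph :: "('v, 'e) sgraph \<Rightarrow> bool" where
  "signed_graph G \<longleftrightarrow>
     finite (sg_verts G) \<and> finite (sg_edges G) \<and>
     (\<forall>e\<in>sg_edges G. (\<exists>i. sg_attach G e i \<noteq> None) \<and>
        (\<forall>i v. sg_attach G e i = Some v \<longrightarrow> v \<in> sg_verts G) \<and>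
        sg_sign G e \<in> {1, -1})"

text \<open>For \<open>u = v\<close> the following says that \<open>e\<close> is a loop at \<open>u\<close>, for \<open>u \<noteq> v\<close> that it is a link.\<close>

definition joins :: "('v, 'e) sgraph \<Rightarrow> 'e \<Rightarrow> 'v \<Rightarrow> 'v \<Rightarrow> bool" where
  "joins G e u v \<longleftrightarrow> (\<exists>i. sg_attach G e i = Some u \<and> sg_attach G e (\<not> i) = Some v)"

definition outer_at :: "('v, 'e) sgraph \<Rightarrow> 'e \<Rightarrow> 'v \<Rightarrow> bool" where
  "outer_at G e v \<longleftrightarrow> (\<exists>i. sg_attach G e i = Some v \<and> sg_attach G e (\<not> i) = None)"

definition outer_edges :: "('v, 'e) sgraph \<Rightarrow> 'v set \<Rightarrow> 'e set" where
  "outer_edges G X = {e \<in> sg_edges G. \<exists>v\<in>X. outer_at G e v}"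

definition cross_links :: "('v, 'e) sgraph \<Rightarrow> 'v set \<Rightarrow> 'e set" where
  "cross_links G X = {e \<in> sg_edges G. \<exists>u\<in>X. \<exists>v\<in>sg_verts G - X. joins G e u v}"

text \<open>\<open>sg_induced G X\<close> is \<open>\<Sigma>[X]\<close> and \<open>sg_induced_outer G X\<close> is \<open>\<Sigma>[X)\<close>.\<close>

definition sg_induced :: "('v, 'e) sgraph \<Rightarrow> 'v set \<Rightarrow> ('v, 'e) sgraph" where
  "sg_induced G X =
     G\<lparr>sg_verts := X, sg_edges := {e \<in> sg_edges G. \<exists>u\<in>X. \<exists>v\<in>X. joins G e u v}\<rparr>"

definition sg_induced_outer :: "('v, 'e) sgraph \<Rightarrow> 'v set \<Rightarrow> ('v, 'e) sgraph" where
  "sg_induced_outer G X =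
     G\<lparr>sg_verts := X, sg_edges := sg_edges (sg_induced G X) \<union> outer_edges G X\<rparr>"

definition sg_delete :: "('v, 'e) sgraph \<Rightarrow> 'e set \<Rightarrow> ('v, 'e) sgraph" where
  "sg_delete G S = G\<lparr>sg_edges := sg_edges G - S\<rparr>"

definition sg_subgraph :: "('v, 'e) sgraph \<Rightarrow> ('v, 'e) sgraph \<Rightarrow> bool" where
  "sg_subgraph H G \<longleftrightarrow>
     signed_graph H \<and> sg_verts H \<subseteq> sg_verts G \<and> sg_edges H \<subseteq> sg_edges G \<and>
     (\<forall>e\<in>sg_edges H. sg_attach H e = sg_attach G e \<and> sg_sign H e = sg_sign G e)"

definition sg_adj :: "('v, 'e) sgraph \<Rightarrow> 'v \<Rightarrow> 'v \<Rightarrow> bool" where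
  "sg_adj G u v \<longleftrightarrow> (\<exists>e\<in>sg_edges G. joins G e u v)"

definition sg_connected :: "('v, 'e) sgraph \<Rightarrow> bool" where
  "sg_connected G \<longleftrightarrow>
     sg_verts G \<noteq> {} \<and> (\<forall>u\<in>sg_verts G. \<forall>v\<in>sg_verts G. (sg_adj G)\<^sup>*\<^sup>* u v)"

text \<open>A component contains the outer-edges at its vertices.\<close>

definition sg_components :: "('v, 'e) sgraph \<Rightarrow> ('v, 'e) sgraph set" where
  "sg_components G =
     (\<lambda>v. sg_induced_outer G {u \<in> sg_verts G. (sg_adj G)\<^sup>*\<^sup>* v u}) ` sg_verts G"

text \<open>Both ends of an edge are counted, so a loop contributes 2.\<close>

definition sg_degree :: "('v, 'e) sgraph \<Rightarrow> 'v \<Rightarrow> nat" where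
  "sg_degree G v = card {(e, i). e \<in> sg_edges G \<and> sg_attach G e i = Some v}"

definition sg_circle :: "('v, 'e) sgraph \<Rightarrow> bool" where
  "sg_circle C \<longleftrightarrow>
     sg_connected C \<and> (\<forall>v\<in>sg_verts C. sg_degree C v = 2) \<and> outer_edges C (sg_verts C) = {}"

definition sg_balanced :: "('v, 'e) sgraph \<Rightarrow> bool" where
  "sg_balanced G \<longleftrightarrow>
     outer_edges G (sg_verts G) = {} \<and>
     (\<forall>C. sg_subgraph C G \<and> sg_circle C \<longrightarrow> (\<Prod>e\<in>sg_edges C. sg_sign C e) = 1)"

definition num_balanced :: "('v, 'e) sgraph \<Rightarrow> nat" where
  "num_balanced G = card {C \<in> sg_components G. sg_balanced C}"

definition switching_on :: "('v, 'e) sgraph \<Rightarrow> 'v set \<Rightarrow> ('v \<Rightarrow> int) \<Rightarrow> bool" where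
  "switching_on G X \<nu> \<longleftrightarrow>
     (\<forall>v\<in>sg_verts G. \<nu> v \<in> {1, -1}) \<and> (\<forall>v\<in>sg_verts G - X. \<nu> v = 1)"

text \<open>One factor for each attached end: \<open>\<nu> u * \<sigma> e * \<nu> v\<close> for a loop or link \<open>e = uv\<close>,
  \<open>\<nu> u * \<sigma> e\<close> for an outer-edge at \<open>u\<close>.\<close>

definition sg_switch :: "('v, 'e) sgraph \<Rightarrow> ('v \<Rightarrow> int) \<Rightarrow> ('v, 'e) sgraph" where
  "sg_switch G \<nu> =
     G\<lparr>sg_sign := \<lambda>e. sg_sign G e *
         (\<Prod>i\<in>UNIV. case sg_attach G e i of None \<Rightarrow> 1 | Some v \<Rightarrow> \<nu> v)\<rparr>"

definition neg_edges :: "('v, 'e) sgraph \<Rightarrow> 'v set \<Rightarrow> ('v \<Rightarrow> int) \<Rightarrow> 'e set" where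
  "neg_edges G X \<nu> = {e \<in> sg_edges (sg_induced G X). sg_sign (sg_switch G \<nu>) e = -1}"

definition sg_delta :: "('v, 'e) sgraph \<Rightarrow> 'v set \<Rightarrow> ('v \<Rightarrow> int) \<Rightarrow> 'e set" where
  "sg_delta G X \<nu> = cross_links G X \<union> neg_edges G X \<nu> \<union> outer_edges G X"

text \<open>\<open>sg_cut_via G X \<nu> U\<close> says that \<open>U = \<delta>X\<^sup>\<nu>\<close> is a cut, presented by \<open>X\<close> and \<open>\<nu>\<close>. The graph
  \<open>(\<Sigma>[X] \<setminus> U) \<union> e\<close> is written as \<open>\<Sigma>[X] \<setminus> (U \<setminus> {e})\<close>.\<close>

definition sg_cut_via ::
    "('v, 'e) sgraph \<Rightarrow> 'v set \<Rightarrow> ('v \<Rightarrow> int) \<Rightarrow> 'e set \<Rightarrow> bool" where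
  "sg_cut_via G X \<nu> U \<longleftrightarrow>
     X \<noteq> {} \<and> X \<subseteq> sg_verts G \<and> switching_on G X \<nu> \<and> U = sg_delta G X \<nu> \<and> U \<noteq> {} \<and>
     sg_balanced (sg_delete (sg_induced G X) U) \<and>
     (\<forall>e\<in>sg_edges (sg_induced G X) \<inter> U. sg_sign (sg_switch G \<nu>) e = -1) \<and>
     (\<forall>e\<in>sg_edges (sg_induced G X) - U. sg_sign (sg_switch G \<nu>) e = 1) \<and>
     (\<forall>e\<in>sg_edges (sg_induced G X) \<inter> U. \<not> sg_balanced (sg_delete (sg_induced G X) (U - {e})))"

definition sg_cut :: "('v, 'e) sgraph \<Rightarrow> 'e set \<Rightarrow> bool" where
  "sg_cut G U \<longleftrightarrow> (\<exists>X \<nu>. sg_cut_via G X \<nu> U)"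

definition sg_bond :: "('v, 'e) sgraph \<Rightarrow> 'e set \<Rightarrow> bool" where
  "sg_bond G U \<longleftrightarrow> sg_cut G U \<and> \<not> (\<exists>U'. sg_cut G U' \<and> U' \<subset> U)"

end

theory Submission
  imports Defs
begin

text \<open>
  Call a vertex set \<open>Y\<close> of \<open>\<Sigma>\<close> together with a switching \<open>\<nu>\<close> a positive part if every edge with an end
  in \<open>Y\<close> has both its ends in \<open>Y\<close> and is positive after switching by \<open>\<nu>\<close>. Harary's theorem says that
  a signed graph is balanced iff some \<open>\<nu>\<close> makes all of it a positive part
  (\<open>balanced_iff_positive_part\<close>). Hence a component is balanced iff it is a positive part, and
  \<open>b(\<Sigma>) > 0\<close> iff \<open>\<Sigma>\<close> has a nonempty positive part (\<open>num_balanced_pos_iff\<close>). Positive parts survive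
  the deletion of edges and can be intersected, glued and switched by hand, so circles and paths
  occur only in the proof of Harary's theorem.

  Let \<open>\<Sigma>\<close> be connected and unbalanced, so that \<open>b(\<Sigma>) = 0\<close>. For a cut \<open>U = \<delta>X\<^sup>\<nu>\<close> the set \<open>X\<close> with \<open>\<nu>\<close>
  is a positive part of \<open>\<Sigma> \<setminus> U\<close>; this gives (a). Conversely, if \<open>b(\<Sigma> \<setminus> S) > 0\<close> and \<open>X\<close> is the vertex
  set of a balanced component of \<open>\<Sigma> \<setminus> S\<close>, positive after switching by \<open>\<nu>\<close>, then \<open>\<delta>X\<^sup>\<nu>\<close> is a cut
  inside \<open>S\<close>. So the edge sets containing a cut are exactly those whose deletion creates a balanced
  component (\<open>contains_cut_iff\<close>), and the bonds are the minimal sets of this kind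
  (\<open>bond_iff_minimal\<close>).

  For (b), let \<open>U = \<delta>X\<^sup>\<nu>\<close> be a cut. If \<open>\<Sigma>[X]\<close> is disconnected or \<open>\<Sigma>[X\<^sup>c)\<close> has a balanced component,
  one edge of \<open>U\<close> can be restored while a positive part remains: in the first case one of the pieces
  of \<open>X\<close>, in the second \<open>X\<close> together with the balanced component, switched so that the restored link
  is positive. Otherwise \<open>X\<close> is the only nonempty positive part of \<open>\<Sigma> \<setminus> U\<close> (\<open>unique_positive_part\<close>), and
  restoring any edge of \<open>U\<close> destroys it, so \<open>U\<close> is a bond. That uniqueness also shows
  \<open>b(\<Sigma> \<setminus> U) = 1\<close>, which is all that (c) adds to the characterization of bonds as minimal sets.
\<close>

section \<open>Edges, adjacency and reachability\<close>

lemma signed_graphD: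
  assumes "signed_graph G" "e \<in> sg_edges G"
  shows "sg_attach G e i = Some v \<Longrightarrow> v \<in> sg_verts G" and "sg_sign G e \<in> {1, -1}"
    and "\<exists>i v. sg_attach G e i = Some v"
  using assms unfolding signed_graph_def by blast+

lemma joins_sym: "joins G e u v \<Longrightarrow> joins G e v u"
  by (auto simp: joins_def ex_bool_eq)

lemma sg_delete_simps [simp]:
  "sg_verts (sg_delete G S) = sg_verts G" "sg_edges (sg_delete G S) = sg_edges G - S"
  "sg_attach (sg_delete G S) = sg_attach G" "sg_sign (sg_delete G S) = sg_sign G"
  "joins (sg_delete G S) = joins G"
  by (auto simp: sg_delete_def joins_def fun_eq_iff)

lemma sg_induced_simps [simp]:
  "sg_verts (sg_induced G X) = X" "sg_attach (sg_induced G X) = sg_attach G"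
  "sg_sign (sg_induced G X) = sg_sign G" "joins (sg_induced G X) = joins G"
  by (auto simp: sg_induced_def joins_def fun_eq_iff)

lemma joinsI: "sg_attach G e i = Some u \<Longrightarrow> sg_attach G e (\<not> i) = Some v \<Longrightarrow> joins G e u v"
  unfolding joins_def by blast

lemma sg_adj_sym: "sg_adj G u v \<Longrightarrow> sg_adj G v u"
  unfolding sg_adj_def using joins_sym by metis

lemma reachable_sym: "(sg_adj G)\<^sup>*\<^sup>* u v \<Longrightarrow> (sg_adj G)\<^sup>*\<^sup>* v u"
  by (metis sg_adj_sym symp_def symp_rtranclp)

lemma reachable_adj_iff: "sg_adj G x y \<Longrightarrow> (sg_adj G)\<^sup>*\<^sup>* u x \<longleftrightarrow> (sg_adj G)\<^sup>*\<^sup>* u y"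
  using sg_adj_sym by (metis rtranclp.rtrancl_into_rtrancl)

lemma reachable_mono:
  assumes "(sg_adj G)\<^sup>*\<^sup>* u v" "sg_edges G \<subseteq> sg_edges H" "sg_attach G = sg_attach H"
  shows "(sg_adj H)\<^sup>*\<^sup>* u v"
proof -
  have "sg_adj G \<le> sg_adj H"
    using assms(2,3) unfolding sg_adj_def joins_def by (intro predicate2I) (metis subsetD)
  from rtranclp_mono[OF this] assms(1) show ?thesis by (rule predicate2D)
qed

section \<open>Positive parts\<close>

text \<open>A positive part is a union of vertex sets of balanced components, with \<open>\<nu>\<close> as the witness of
  balance. It may be empty. Demanding that the other end of an edge at \<open>Y\<close> exists and lies in \<open>Y\<close>
  excludes outer-edges and leaving links by one condition.\<close>

definition positive_part :: "('v, 'e) sgraph \<Rightarrow> 'v set \<Rightarrow> ('v \<Rightarrow> int) \<Rightarrow> bool" where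
  "positive_part H Y \<nu> \<longleftrightarrow>
     Y \<subseteq> sg_verts H \<and> (\<forall>v\<in>Y. \<nu> v \<in> {1, -1}) \<and>
     (\<forall>e\<in>sg_edges H. \<forall>i. \<forall>v\<in>Y. sg_attach H e i = Some v \<longrightarrow>
        (\<exists>w\<in>Y. sg_attach H e (\<not> i) = Some w \<and> \<nu> v * sg_sign H e * \<nu> w = 1))"

lemma positive_partD:
  assumes "positive_part H Y \<nu>" "e \<in> sg_edges H" "sg_attach H e i = Some v" "v \<in> Y"
  obtains w where "w \<in> Y" "sg_attach H e (\<not> i) = Some w" "\<nu> v * sg_sign H e * \<nu> w = 1"
  using assms unfolding positive_part_def by blast

lemma positive_part_mono:
  assumes "positive_part H Y \<nu>" "Y \<subseteq> sg_verts K" "sg_edges K \<subseteq> sg_edges H"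
    and "sg_attach K = sg_attach H" "sg_sign K = sg_sign H"
  shows "positive_part K Y \<nu>"
  using assms unfolding positive_part_def by (metis subsetD)

lemma positive_part_joins:
  assumes "positive_part H Y \<nu>" "e \<in> sg_edges H" "joins H e u v" "u \<in> Y"
  shows "v \<in> Y" and "\<nu> u * sg_sign H e * \<nu> v = 1"
  using assms unfolding positive_part_def joins_def by fastforce+

lemma positive_part_reachable:
  assumes "positive_part H Y \<nu>" "(sg_adj H)\<^sup>*\<^sup>* u v" "u \<in> Y"
  shows "v \<in> Y"
  using assms(2,3)
proof (induction rule: rtranclp_induct)
  case (step y z)
  then show ?case using assms(1) positive_part_joins(1) unfolding sg_adj_def by metis
qed

text \<open>A splitting of a positive part along \<open>Z\<close> that no edge crosses respects components. Applied to \<open>Z\<close> and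
  to its complement, this makes both halves positive.\<close>

lemma positive_part_Int:
  assumes "positive_part H Y \<nu>" and "\<And>e u v. e \<in> sg_edges H \<Longrightarrow> joins H e u v \<Longrightarrow> u \<in> Y \<Longrightarrow> u \<in> Z \<longleftrightarrow> v \<in> Z"
  shows "positive_part H (Y \<inter> Z) \<nu>"
  unfolding positive_part_def
proof (intro conjI ballI allI impI)
  fix e i v assume e: "e \<in> sg_edges H" "v \<in> Y \<inter> Z" "sg_attach H e i = Some v"
  then obtain w where "w \<in> Y" "sg_attach H e (\<not> i) = Some w" "\<nu> v * sg_sign H e * \<nu> w = 1"
    using positive_partD[OF assms(1) e(1,3)] by blast
  then show "\<exists>w\<in>Y \<inter> Z. sg_attach H e (\<not> i) = Some w \<and> \<nu> v * sg_sign H e * \<nu> w = 1"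
    using assms(2)[OF e(1) joinsI[OF e(3)]] e(2) by blast
qed (use assms(1) in \<open>auto simp: positive_part_def\<close>)

lemma positive_part_component:
  assumes "positive_part H Y \<nu>" "v \<in> Y"
  shows "positive_part H {u \<in> sg_verts H. (sg_adj H)\<^sup>*\<^sup>* v u} \<nu>"
proof -
  let ?Z = "{u. (sg_adj H)\<^sup>*\<^sup>* v u}"
  have "positive_part H (Y \<inter> ?Z) \<nu>"
  proof (rule positive_part_Int[OF assms(1)])
    fix e u w assume "e \<in> sg_edges H" "joins H e u w"
    then have "sg_adj H u w" unfolding sg_adj_def by blast
    then show "u \<in> ?Z \<longleftrightarrow> w \<in> ?Z" using reachable_adj_iff by simp
  qed
  moreover have "Y \<inter> ?Z = {u \<in> sg_verts H. (sg_adj H)\<^sup>*\<^sup>* v u}"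
    using assms positive_part_reachable[OF assms(1) _ assms(2)] by (auto simp: positive_part_def)
  ultimately show ?thesis by simp
qed

section \<open>Harary's balance theorem\<close>

text \<open>A loop at \<open>v\<close> counts twice, in agreement with the degree.\<close>

definition end_count :: "('v, 'e) sgraph \<Rightarrow> 'e \<Rightarrow> 'v \<Rightarrow> nat" where
  "end_count G e v = (\<Sum>i\<in>UNIV. if sg_attach G e i = Some v then 1 else 0)"

lemma sg_degree_sum:
  assumes "finite (sg_edges G)"
  shows "sg_degree G v = (\<Sum>e\<in>sg_edges G. end_count G e v)"
proof -
  have "{(e, i). e \<in> sg_edges G \<and> sg_attach G e i = Some v}
      = {p \<in> sg_edges G \<times> UNIV. sg_attach G (fst p) (snd p) = Some v}" by auto
  then have "sg_degree G v
      = (\<Sum>p\<in>sg_edges G \<times> UNIV. if sg_attach G (fst p) (snd p) = Some v then 1 else 0)"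
    unfolding sg_degree_def using assms by (simp add: sum.If_cases Int_def)
  then show ?thesis by (simp add: end_count_def sum.cartesian_product case_prod_beta)
qed

text \<open>Double counting of the attached ends, first by edges and then by vertices.\<close>

lemma switch_factor_prod:
  fixes \<nu> :: "'v \<Rightarrow> int"
  assumes "signed_graph C"
  shows "(\<Prod>e\<in>sg_edges C. \<Prod>i\<in>UNIV. case sg_attach C e i of None \<Rightarrow> 1 | Some v \<Rightarrow> \<nu> v)
    = (\<Prod>v\<in>sg_verts C. \<nu> v ^ sg_degree C v)"
proof -
  have fin: "finite (sg_verts C)" "finite (sg_edges C)"
    using assms by (auto simp: signed_graph_def)
  have "(\<Prod>e\<in>sg_edges C. \<Prod>i\<in>UNIV. case sg_attach C e i of None \<Rightarrow> 1 | Some v \<Rightarrow> \<nu> v)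
    = (\<Prod>e\<in>sg_edges C. \<Prod>i\<in>UNIV. \<Prod>v\<in>sg_verts C.
         \<nu> v ^ (if sg_attach C e i = Some v then 1 else 0))"
  proof (intro prod.cong refl)
    fix e and i :: bool assume e: "e \<in> sg_edges C"
    show "(case sg_attach C e i of None \<Rightarrow> 1 | Some v \<Rightarrow> \<nu> v)
      = (\<Prod>v\<in>sg_verts C. \<nu> v ^ (if sg_attach C e i = Some v then 1 else 0))"
    proof (cases "sg_attach C e i")
      case (Some w)
      then have "w \<in> sg_verts C" using assms e by (auto simp: signed_graph_def)
      have "(\<Prod>v\<in>sg_verts C. \<nu> v ^ (if sg_attach C e i = Some v then 1 else 0))
        = (\<Prod>v\<in>sg_verts C. if w = v then \<nu> v else 1)"
        using Some by (intro prod.cong) auto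
      then show ?thesis using Some fin \<open>w \<in> sg_verts C\<close> by simp
    qed simp
  qed
  also have "\<dots> = (\<Prod>v\<in>sg_verts C. \<Prod>e\<in>sg_edges C. \<Prod>i\<in>UNIV.
         \<nu> v ^ (if sg_attach C e i = Some v then 1 else 0))"
    by (simp add: prod.swap[of _ "UNIV :: bool set"] prod.swap[of _ "sg_edges C" "sg_verts C"])
  also have "\<dots> = (\<Prod>v\<in>sg_verts C. \<nu> v ^ sg_degree C v)"
    by (simp add: sg_degree_sum end_count_def fin power_sum)
  finally show ?thesis .
qed

text \<open>Switching does not change the sign of a circle: every vertex has degree 2 and therefore
  contributes \<open>\<nu>(v)\<^sup>2 = 1\<close>.\<close>

lemma circle_sign_switch:
  assumes C: "signed_graph C" "sg_circle C" and \<nu>: "\<And>v. v \<in> sg_verts C \<Longrightarrow> \<nu> v \<in> {1, -1}"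
  shows "(\<Prod>e\<in>sg_edges C. sg_sign (sg_switch C \<nu>) e) = (\<Prod>e\<in>sg_edges C. sg_sign C e)"
proof -
  have "(\<Prod>v\<in>sg_verts C. \<nu> v ^ sg_degree C v) = 1"
    using C(2) \<nu> by (intro prod.neutral) (fastforce simp: sg_circle_def)
  then show ?thesis
    by (simp add: sg_switch_def prod.distrib switch_factor_prod[OF C(1)])
qed

lemma switch_sign:
  assumes "sg_attach G e i = Some u" "sg_attach G e (\<not> i) = Some v"
  shows "sg_sign (sg_switch G \<nu>) e = \<nu> u * sg_sign G e * \<nu> v"
  using assms by (cases i) (auto simp: sg_switch_def UNIV_bool)

lemma switch_sign_joins:
  assumes "joins G e u v"
  shows "sg_sign (sg_switch G \<nu>) e = \<nu> u * sg_sign G e * \<nu> v"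
  using assms switch_sign unfolding joins_def by metis

text \<open>The easy half of Harary's theorem: after switching all edges are positive, so all circles are
  positive, and switching preserves their signs.\<close>

lemma positive_part_imp_balanced:
  assumes "signed_graph H" "positive_part H (sg_verts H) \<nu>"
  shows "sg_balanced H"
  unfolding sg_balanced_def
proof (intro conjI allI impI)
  show "outer_edges H (sg_verts H) = {}"
    using assms unfolding outer_edges_def outer_at_def positive_part_def by fastforce
  fix C assume C: "sg_subgraph C H \<and> sg_circle C"
  then have sg: "signed_graph C" and sub: "sg_verts C \<subseteq> sg_verts H" "sg_edges C \<subseteq> sg_edges H"
    and att: "\<And>e. e \<in> sg_edges C \<Longrightarrow> sg_attach C e = sg_attach H e \<and> sg_sign C e = sg_sign H e"
    by (auto simp: sg_subgraph_def)
  have pos: "sg_sign (sg_switch C \<nu>) e = 1" if e: "e \<in> sg_edges C" for e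
  proof -
    obtain i v where v: "sg_attach C e i = Some v" "v \<in> sg_verts C"
      using sg e unfolding signed_graph_def by (metis option.exhaust)
    obtain w where w: "sg_attach H e (\<not> i) = Some w" "\<nu> v * sg_sign H e * \<nu> w = 1"
      using positive_partD[OF assms(2), of e i v] e v sub att by (metis subsetD)
    show ?thesis using switch_sign[of C e i v w \<nu>] v w att[OF e] by simp
  qed
  have "(\<Prod>e\<in>sg_edges C. sg_sign (sg_switch C \<nu>) e) = (\<Prod>e\<in>sg_edges C. sg_sign C e)"
    by (rule circle_sign_switch) (use C sg sub assms(2) in \<open>auto simp: positive_part_def\<close>)
  then show "(\<Prod>e\<in>sg_edges C. sg_sign C e) = 1" by (simp add: pos)
qed

text \<open>A simple path from \<open>u\<close> to \<open>v\<close> is recorded by its vertex set \<open>P\<close> and its edge set \<open>F\<close>, because only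
  the subgraph \<open>(P, F)\<close> matters for building circles. The path grows at \<open>u\<close>, and \<open>v\<close> stays fixed.\<close>

inductive simple_path :: "('v, 'e) sgraph \<Rightarrow> 'v \<Rightarrow> 'v \<Rightarrow> 'v set \<Rightarrow> 'e set \<Rightarrow> bool"
  for G v where
  refl: "simple_path G v v {v} {}"
| step: "\<lbrakk>simple_path G v u P F; e \<in> sg_edges G; joins G e w u; w \<notin> P\<rbrakk>
    \<Longrightarrow> simple_path G v w (insert w P) (insert e F)"

lemma simple_path_suffix:
  assumes "simple_path G v u P F" "w \<in> P"
  shows "\<exists>P' F'. simple_path G v w P' F'"
  using assms by induction (auto intro: simple_path.intros)

lemma reachable_imp_simple_path:
  assumes "(sg_adj G)\<^sup>*\<^sup>* u v"
  shows "\<exists>P F. simple_path G v u P F"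
  using assms
proof (induction rule: converse_rtranclp_induct)
  case base
  show ?case by (intro exI) (rule simple_path.refl)
next
  case (step w u)
  then obtain P F e where p: "simple_path G v u P F" "e \<in> sg_edges G" "joins G e w u"
    unfolding sg_adj_def by blast
  show ?case
  proof (cases "w \<in> P")
    case True
    then show ?thesis using simple_path_suffix[OF p(1)] by blast
  next
    case False
    then show ?thesis using simple_path.step[OF p] by blast
  qed
qed

lemma simple_path_ends:
  assumes "simple_path G v u P F"
  shows "u \<in> P" "v \<in> P" "finite P" "finite F" "F \<subseteq> sg_edges G"
    "\<And>e i. e \<in> F \<Longrightarrow> \<exists>x\<in>P. sg_attach G e i = Some x"
proof -
  have "u \<in> P \<and> v \<in> P \<and> finite P \<and> finite F \<and> F \<subseteq> sg_edges G \<and>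
    (\<forall>e\<in>F. \<forall>i. \<exists>x\<in>P. sg_attach G e i = Some x)"
    using assms
  proof induction
    case (step u P F e w)
    then have "\<exists>x\<in>insert w P. sg_attach G e i = Some x" for i
      by (cases i) (auto simp: joins_def ex_bool_eq)
    then show ?case using step by auto
  qed simp
  then show "u \<in> P" "v \<in> P" "finite P" "finite F" "F \<subseteq> sg_edges G"
    "\<And>e i. e \<in> F \<Longrightarrow> \<exists>x\<in>P. sg_attach G e i = Some x" by auto
qed

lemma joins_end_count:
  assumes "joins G e u v"
  shows "end_count G e x = of_bool (x = u) + of_bool (x = v)"
  using assms by (auto simp: end_count_def joins_def UNIV_bool ex_bool_eq)

text \<open>Each of the two ends of a path misses one incidence, so that closing the path with one more edge
  gives degree 2 everywhere. The formula covers the trivial path, whose vertex \<open>u = v\<close> misses both.\<close>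

lemma simple_path_degree:
  assumes "simple_path G v u P F" "x \<in> P"
  shows "(\<Sum>e\<in>F. end_count G e x)
    + of_bool (x = u) + of_bool (x = v) = 2"
  using assms
proof (induction arbitrary: x)
  case (step u P F e w)
  note ends = simple_path_ends[OF step.hyps(1)]
  have "e \<notin> F"
    using ends(6)[of e True] ends(6)[of e False] step.hyps(3,4) by (auto simp: joins_def ex_bool_eq)
  have neq: "w \<noteq> u" "w \<noteq> v" using ends step.hyps by auto
  have 0: "(\<Sum>e\<in>F. end_count G e w) = 0"
  proof (rule sum.neutral, rule ballI)
    fix d assume "d \<in> F"
    then have "sg_attach G d i \<noteq> Some w" for i using ends(6)[of d i] step.hyps(4) by auto
    then show "end_count G d w = 0" by (simp add: end_count_def)
  qed
  have eq: "(\<Sum>e\<in>insert e F. end_count G e x)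
     = of_bool (x = w) + of_bool (x = u)
       + (\<Sum>e\<in>F. end_count G e x)"
    using ends(4) \<open>e \<notin> F\<close> by (simp add: joins_end_count[OF step.hyps(3)])
  show ?case
  proof (cases "x = w")
    case True
    then show ?thesis using eq 0 neq by simp
  next
    case False
    then have "x \<in> P" using step.prems by simp
    then show ?thesis using step.IH[of x] eq False by simp
  qed
qed simp

text \<open>The vertex set \<open>P'\<close> is arbitrary because adjacency depends on the edges alone.\<close>

lemma simple_path_connected:
  assumes "simple_path G v u P F" "x \<in> P"
  shows "(sg_adj (G\<lparr>sg_verts := P', sg_edges := F\<rparr>))\<^sup>*\<^sup>* u x"
  using assms
proof (induction arbitrary: x)
  case (step u P F e w)
  let ?G = "\<lambda>F. G\<lparr>sg_verts := P', sg_edges := F\<rparr>"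
  have wu: "sg_adj (?G (insert e F)) w u"
    using step.hyps(3) by (auto simp: sg_adj_def joins_def)
  show ?case
  proof (cases "x = w")
    case False
    then have "(sg_adj (?G F))\<^sup>*\<^sup>* u x" using step.IH[of x] step.prems by simp
    then have "(sg_adj (?G (insert e F)))\<^sup>*\<^sup>* u x" by (rule reachable_mono) auto
    with wu show ?thesis by (rule converse_rtranclp_into_rtranclp)
  qed simp
qed simp

text \<open>For \<open>u = v\<close> the path is trivial and the circle is the loop \<open>e\<close>.\<close>

lemma simple_path_closes_to_circle:
  assumes "simple_path G v u P F" "joins G e u v" "e \<notin> F"
  shows "sg_circle (G\<lparr>sg_verts := P, sg_edges := insert e F\<rparr>)" (is "sg_circle ?C")
proof -
  note ends = simple_path_ends[OF assms(1)]
  have "(sg_adj ?C)\<^sup>*\<^sup>* u x" if "x \<in> P" for x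
    by (rule reachable_mono[OF simple_path_connected[OF assms(1) that, of P]]) auto
  then have "sg_connected ?C"
    using ends(1) unfolding sg_connected_def
    by simp (metis reachable_sym rtranclp_trans empty_iff)
  moreover have "sg_degree ?C x = 2" if "x \<in> P" for x
  proof -
    have "sg_degree ?C x = (\<Sum>e\<in>insert e F. end_count G e x)"
      using ends(4) by (subst sg_degree_sum) (auto simp: end_count_def)
    also have "\<dots> = of_bool (x = u) + of_bool (x = v)
       + (\<Sum>e\<in>F. end_count G e x)"
      using ends(4) assms(3) by (simp add: joins_end_count[OF assms(2)])
    finally show ?thesis using simple_path_degree[OF assms(1) that] by simp
  qed
  moreover have "outer_edges ?C P = {}"
  proof -
    have "\<exists>x. sg_attach G d i = Some x" if "d \<in> insert e F" for d i
      using that ends(6)[of d i] assms(2) by (cases i) (auto simp: joins_def ex_bool_eq)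
    then have "sg_attach G d i \<noteq> None" if "d \<in> insert e F" for d i
      using that by (metis option.distinct(1))
    then show ?thesis by (auto simp: outer_edges_def outer_at_def)
  qed
  ultimately show ?thesis by (simp add: sg_circle_def)
qed

text \<open>An edge between different components can be added without losing positivity: if it has the wrong sign, reverse the
  switching on the component of one of its ends.\<close>

lemma positive_part_extend:
  assumes pos: "positive_part K (sg_verts K) \<nu>"
    and e: "sg_attach K e i = Some u" "sg_attach K e (\<not> i) = Some v" "sg_sign K e \<in> {1, -1}"
    and uv: "u \<in> sg_verts K" "v \<in> sg_verts K" "\<not> (sg_adj K)\<^sup>*\<^sup>* u v"
  shows "\<exists>\<mu>. positive_part (K\<lparr>sg_edges := insert e (sg_edges K)\<rparr>) (sg_verts K) \<mu>"
proof -
  define \<mu> where "\<mu> x = (if \<nu> u * sg_sign K e * \<nu> v \<noteq> 1 \<and> (sg_adj K)\<^sup>*\<^sup>* u x then - \<nu> x else \<nu> x)" for x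
  have \<nu>: "\<nu> x \<in> {1, -1}" if "x \<in> sg_verts K" for x
    using pos that by (auto simp: positive_part_def)
  have \<mu>: "\<mu> x \<in> {1, -1}" if "x \<in> sg_verts K" for x
    using \<nu>[OF that] by (auto simp: \<mu>_def)
  have new: "\<mu> u * sg_sign K e * \<mu> v = 1"
    using \<nu>[OF uv(1)] \<nu>[OF uv(2)] e(3) uv(3) by (auto simp: \<mu>_def)
  have "\<exists>w\<in>sg_verts K. sg_attach K d (\<not> j) = Some w \<and> \<mu> x * sg_sign K d * \<mu> w = 1"
    if d: "d \<in> insert e (sg_edges K)" "x \<in> sg_verts K" "sg_attach K d j = Some x" for d j x
  proof (cases "d = e")
    case True
    then show ?thesis using e uv new d(3) by (cases "j = i") (auto simp: mult_ac)
  next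
    case False
    with d(1) have dK: "d \<in> sg_edges K" by simp
    obtain w where w: "w \<in> sg_verts K" "sg_attach K d (\<not> j) = Some w" "\<nu> x * sg_sign K d * \<nu> w = 1"
      using positive_partD[OF pos dK d(3,2)] by blast
    have "sg_adj K x w" using joinsI[OF d(3) w(2)] dK by (auto simp: sg_adj_def)
    then have "(sg_adj K)\<^sup>*\<^sup>* u x \<longleftrightarrow> (sg_adj K)\<^sup>*\<^sup>* u w"
      by (rule reachable_adj_iff)
    then show ?thesis using w by (auto simp: \<mu>_def)
  qed
  then have "positive_part (K\<lparr>sg_edges := insert e (sg_edges K)\<rparr>) (sg_verts K) \<mu>"
    using \<mu> by (simp add: positive_part_def)
  then show ?thesis by blast
qed

text \<open>The hard half of Harary's theorem, by adding the edges one at a time. An edge joining different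
  components of what has been built is handled by \<open>positive_part_extend\<close>. Otherwise a path between its
  ends closes to a circle, which is positive by assumption. All edges of the path are positive after
  switching and switching preserves the sign of the circle, so the new edge is positive too.\<close>

lemma balanced_imp_positive_part:
  assumes H: "signed_graph H" and bal: "sg_balanced H"
  shows "\<exists>\<nu>. positive_part H (sg_verts H) \<nu>"
proof -
  have "finite (sg_edges H)" using H by (simp add: signed_graph_def)
  have "\<exists>\<nu>. positive_part (H\<lparr>sg_edges := F\<rparr>) (sg_verts H) \<nu>" if "F \<subseteq> sg_edges H" for F
    using finite_subset[OF that \<open>finite (sg_edges H)\<close>] that
  proof (induction F rule: finite_induct)
    case empty
    have "positive_part (H\<lparr>sg_edges := {}\<rparr>) (sg_verts H) (\<lambda>_. 1)"
      by (simp add: positive_part_def)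
    then show ?case by blast
  next
    case (insert e F)
    let ?K = "H\<lparr>sg_edges := F\<rparr>"
    from insert obtain \<nu> where \<nu>: "positive_part ?K (sg_verts H) \<nu>" by auto
    have eH: "e \<in> sg_edges H" and FH: "F \<subseteq> sg_edges H" using insert.prems by auto
    obtain i u where u: "sg_attach H e i = Some u" "u \<in> sg_verts H"
      using signed_graphD(1,3)[OF H eH] by blast
    have "e \<notin> outer_edges H (sg_verts H)" using bal by (simp add: sg_balanced_def)
    then have "sg_attach H e (\<not> i) \<noteq> None"
      using u eH by (simp add: outer_edges_def outer_at_def)
    then obtain v where v: "sg_attach H e (\<not> i) = Some v" by blast
    have vV: "v \<in> sg_verts H" using signed_graphD(1)[OF H eH v] .
    have s: "sg_sign H e \<in> {1, -1}" using signed_graphD(2)[OF H eH] .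
    show ?case
    proof (cases "(sg_adj ?K)\<^sup>*\<^sup>* u v")
      case False
      then show ?thesis using positive_part_extend[of ?K \<nu> e i u v] \<nu> u v vV s by simp
    next
      case True
      then have "\<exists>P F'. simple_path ?K v u P F'" by (rule reachable_imp_simple_path)
      then obtain P F' where p: "simple_path ?K v u P F'" by blast
      note ends = simple_path_ends[OF p]
      let ?C = "H\<lparr>sg_verts := P, sg_edges := insert e F'\<rparr>"
      have uv: "joins H e u v" by (rule joinsI[OF u(1) v])
      have "sg_circle (?K\<lparr>sg_verts := P, sg_edges := insert e F'\<rparr>)"
        by (rule simple_path_closes_to_circle[OF p])
          (use uv ends(5) insert.hyps in \<open>auto simp: joins_def\<close>)
      then have circ: "sg_circle ?C" by simp
      have PV: "P \<subseteq> sg_verts H"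
      proof
        fix x assume "x \<in> P"
        then have "(sg_adj (?K\<lparr>sg_verts := sg_verts H, sg_edges := F'\<rparr>))\<^sup>*\<^sup>* u x"
          by (rule simple_path_connected[OF p])
        then have "(sg_adj ?K)\<^sup>*\<^sup>* u x" by (rule reachable_mono) (use ends(5) in auto)
        then show "x \<in> sg_verts H" using positive_part_reachable[OF \<nu>] u by blast
      qed
      have att: "\<exists>x\<in>P. sg_attach H d j = Some x" if "d \<in> insert e F'" for d j
        using that ends(1,2,6) u v by (cases "d = e"; cases "j = i") auto
      have FE: "insert e F' \<subseteq> sg_edges H" using ends(5) FH eH by auto
      have sg: "signed_graph ?C"
        unfolding signed_graph_def
      proof (intro conjI ballI)
        fix d assume "d \<in> sg_edges ?C"
        then have d: "d \<in> insert e F'" by simp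
        show "\<exists>i. sg_attach ?C d i \<noteq> None" using att[OF d, of True] by auto
        show "\<forall>i v. sg_attach ?C d i = Some v \<longrightarrow> v \<in> sg_verts ?C"
        proof (intro allI impI)
          fix j x assume "sg_attach ?C d j = Some x"
          then show "x \<in> sg_verts ?C" using att[OF d, of j] by auto
        qed
        show "sg_sign ?C d \<in> {1, -1}" 
          using signed_graphD(2)[OF H, of d] subsetD[OF FE d] by simp
      qed (use ends in auto)
      have sub: "sg_subgraph ?C H"
        using sg PV FE by (auto simp: sg_subgraph_def)
      have pos: "sg_sign (sg_switch ?C \<nu>) d = 1" if "d \<in> F'" for d
      proof -
        have "\<exists>x\<in>P. sg_attach H d True = Some x" by (rule att) (use that in simp)
        then obtain x where x: "x \<in> P" "sg_attach H d True = Some x" by blast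
        have d: "d \<in> sg_edges ?K" "x \<in> sg_verts H" using that x(1) ends(5) PV by auto
        obtain y where y: "sg_attach H d (\<not> True) = Some y" "\<nu> x * sg_sign H d * \<nu> y = 1"
          using positive_partD[OF \<nu> d(1) _ d(2), of True] x(2) by auto
        then show ?thesis using switch_sign[of ?C d True x y \<nu>] x by simp
      qed
      have "e \<notin> F'" using ends(5) insert.hyps by auto
      have "(\<Prod>d\<in>sg_edges ?C. sg_sign (sg_switch ?C \<nu>) d) = (\<Prod>d\<in>sg_edges ?C. sg_sign ?C d)"
        by (rule circle_sign_switch[OF sg circ]) (use \<nu> PV in \<open>auto simp: positive_part_def\<close>)
      also have "\<dots> = 1" using bal sub circ unfolding sg_balanced_def by blast
      \<comment> \<open>All the other factors of this product are 1.\<close>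
      finally have "sg_sign (sg_switch ?C \<nu>) e = 1"
        using ends(4) \<open>e \<notin> F'\<close> pos by simp
      then have "\<nu> u * sg_sign H e * \<nu> v = 1"
        using switch_sign[of ?C e i u v \<nu>] u v by simp
      then have "\<exists>w\<in>sg_verts H. sg_attach H e (\<not> j) = Some w \<and> \<nu> x * sg_sign H e * \<nu> w = 1"
        if "sg_attach H e j = Some x" for j x
        using that u v vV by (cases "j = i") (auto simp: mult_ac)
      then have "positive_part (H\<lparr>sg_edges := insert e F\<rparr>) (sg_verts H) \<nu>"
        using \<nu> unfolding positive_part_def by simp
      then show ?thesis by blast
    qed
  qed
  from this[of "sg_edges H"] show ?thesis by simp
qed

lemma balanced_iff_positive_part:
  assumes "signed_graph H"
  shows "sg_balanced H \<longleftrightarrow> (\<exists>\<nu>. positive_part H (sg_verts H) \<nu>)"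
  using positive_part_imp_balanced balanced_imp_positive_part assms by blast

section \<open>Counting balanced components\<close>

lemma signed_graph_delete: "signed_graph G \<Longrightarrow> signed_graph (sg_delete G S)"
  by (auto simp: signed_graph_def sg_delete_def)

lemma signed_graph_induced:
  assumes "signed_graph G" "X \<subseteq> sg_verts G"
  shows "signed_graph (sg_induced G X)"
  unfolding signed_graph_def
proof (intro conjI ballI allI impI)
  fix e assume "e \<in> sg_edges (sg_induced G X)"
  then obtain u v where e: "e \<in> sg_edges G" "u \<in> X" "v \<in> X" "joins G e u v"
    by (auto simp: sg_induced_def)
  show "\<exists>i. sg_attach (sg_induced G X) e i \<noteq> None"
    using e(4) by (auto simp: sg_induced_def joins_def)
  show "sg_sign (sg_induced G X) e \<in> {1, -1}"
    using signed_graphD(2)[OF assms(1) e(1)] by (simp add: sg_induced_def)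
  fix i x assume "sg_attach (sg_induced G X) e i = Some x"
  then show "x \<in> sg_verts (sg_induced G X)"
    using e by (cases i) (auto simp: sg_induced_def joins_def ex_bool_eq)
qed (use assms finite_subset in \<open>auto simp: signed_graph_def sg_induced_def\<close>)

lemma signed_graph_induced_outer:
  assumes "signed_graph G" "X \<subseteq> sg_verts G"
  shows "signed_graph (sg_induced_outer G X)"
  unfolding signed_graph_def
proof (intro conjI ballI allI impI)
  fix e assume e: "e \<in> sg_edges (sg_induced_outer G X)"
  then have eG: "e \<in> sg_edges G"
    by (auto simp: sg_induced_outer_def sg_induced_def outer_edges_def)
  show "\<exists>i. sg_attach (sg_induced_outer G X) e i \<noteq> None"
    using signed_graphD(3)[OF assms(1) eG] by (auto simp: sg_induced_outer_def)
  show "sg_sign (sg_induced_outer G X) e \<in> {1, -1}"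
    using signed_graphD(2)[OF assms(1) eG] by (simp add: sg_induced_outer_def)
  fix i x assume "sg_attach (sg_induced_outer G X) e i = Some x"
  then show "x \<in> sg_verts (sg_induced_outer G X)"
    using e by (cases i)
      (auto simp: sg_induced_outer_def sg_induced_def outer_edges_def outer_at_def joins_def ex_bool_eq)
qed (use assms finite_subset in \<open>auto simp: signed_graph_def sg_induced_outer_def sg_induced_def outer_edges_def\<close>)

lemma induced_outer_edgeI:
  assumes "e \<in> sg_edges G" "sg_attach G e i = Some v" "v \<in> Y"
    and "\<And>w. sg_attach G e (\<not> i) = Some w \<Longrightarrow> w \<in> Y"
  shows "e \<in> sg_edges (sg_induced_outer G Y)"
proof (cases "sg_attach G e (\<not> i)")
  case None
  then have "e \<in> outer_edges G Y" using assms(1-3) by (auto simp: outer_edges_def outer_at_def)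
  then show ?thesis by (simp add: sg_induced_outer_def)
next
  case (Some w)
  then have "e \<in> sg_edges (sg_induced G Y)"
    using assms joinsI[OF assms(2) Some] by (auto simp: sg_induced_def)
  then show ?thesis by (simp add: sg_induced_outer_def)
qed

text \<open>Closedness of \<open>Y\<close> under adjacency leaves only outer-edges to check, and \<open>\<Sigma>[Y)\<close> contains those
  at \<open>Y\<close>.\<close>

lemma positive_part_induced_outer:
  assumes "Y \<subseteq> sg_verts H" "\<And>e u w. e \<in> sg_edges H \<Longrightarrow> joins H e u w \<Longrightarrow> u \<in> Y \<Longrightarrow> w \<in> Y"
  shows "positive_part (sg_induced_outer H Y) Y \<nu> \<longleftrightarrow> positive_part H Y \<nu>"
proof
  assume pos: "positive_part (sg_induced_outer H Y) Y \<nu>"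
  show "positive_part H Y \<nu>"
    unfolding positive_part_def
  proof (intro conjI ballI allI impI)
    fix e i v assume e: "e \<in> sg_edges H" "v \<in> Y" "sg_attach H e i = Some v"
    have "e \<in> sg_edges (sg_induced_outer H Y)"
      using induced_outer_edgeI[OF e(1,3,2)] assms(2)[OF e(1) joinsI[OF e(3)] e(2)] by blast
    then show "\<exists>w\<in>Y. sg_attach H e (\<not> i) = Some w \<and> \<nu> v * sg_sign H e * \<nu> w = 1"
      using pos e by (simp add: positive_part_def sg_induced_outer_def)
  qed (use assms pos in \<open>auto simp: positive_part_def\<close>)
next
  assume "positive_part H Y \<nu>"
  then show "positive_part (sg_induced_outer H Y) Y \<nu>"
    by (rule positive_part_mono)
      (auto simp: sg_induced_outer_def sg_induced_def outer_edges_def)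
qed

definition component_verts :: "('v, 'e) sgraph \<Rightarrow> 'v \<Rightarrow> 'v set" where
  "component_verts G v = {u \<in> sg_verts G. (sg_adj G)\<^sup>*\<^sup>* v u}"

lemma sg_components_eq:
  "sg_components G = (\<lambda>v. sg_induced_outer G (component_verts G v)) ` sg_verts G"
  by (simp add: sg_components_def component_verts_def)

lemma component_balanced_iff:
  assumes "signed_graph H"
  shows "sg_balanced (sg_induced_outer H (component_verts H v)) \<longleftrightarrow>
    (\<exists>\<nu>. positive_part H (component_verts H v) \<nu>)"
proof -
  let ?Y = "component_verts H v"
  have Y: "?Y \<subseteq> sg_verts H" by (auto simp: component_verts_def)
  have "sg_verts (sg_induced_outer H ?Y) = ?Y" by (simp add: sg_induced_outer_def)
  moreover have "w \<in> ?Y" if "e \<in> sg_edges H" "joins H e u w" "u \<in> ?Y" for e u w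
  proof -
    have "sg_adj H u w" using that by (auto simp: sg_adj_def)
    moreover have "w \<in> sg_verts H"
      using signed_graphD(1)[OF assms that(1)] that(2) unfolding joins_def by blast
    ultimately show ?thesis
      using that(3) by (auto simp: component_verts_def intro: rtranclp.rtrancl_into_rtrancl)
  qed
  ultimately show ?thesis
    using balanced_iff_positive_part[OF signed_graph_induced_outer[OF assms Y]]
      positive_part_induced_outer[OF Y] by simp
qed

lemma ex_balanced_component_iff:
  assumes "signed_graph H"
  shows "(\<exists>C\<in>sg_components H. sg_balanced C) \<longleftrightarrow> (\<exists>Y \<nu>. Y \<noteq> {} \<and> positive_part H Y \<nu>)"
proof
  assume "\<exists>C\<in>sg_components H. sg_balanced C"
  then obtain v \<nu> where "v \<in> sg_verts H" "positive_part H (component_verts H v) \<nu>"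
    unfolding sg_components_eq using component_balanced_iff[OF assms] by blast
  moreover have "v \<in> component_verts H v" using calculation by (simp add: component_verts_def)
  ultimately show "\<exists>Y \<nu>. Y \<noteq> {} \<and> positive_part H Y \<nu>" by blast
next
  assume "\<exists>Y \<nu>. Y \<noteq> {} \<and> positive_part H Y \<nu>"
  then obtain Y \<nu> v where Y: "positive_part H Y \<nu>" "v \<in> Y" by blast
  then have "v \<in> sg_verts H" by (auto simp: positive_part_def)
  moreover have "positive_part H (component_verts H v) \<nu>"
    using positive_part_component[OF Y] by (simp add: component_verts_def)
  ultimately show "\<exists>C\<in>sg_components H. sg_balanced C"
    unfolding sg_components_eq using component_balanced_iff[OF assms] by blast
qed

lemma num_balanced_pos_iff:
  assumes "signed_graph H"
  shows "num_balanced H > 0 \<longleftrightarrow> (\<exists>Y \<nu>. Y \<noteq> {} \<and> positive_part H Y \<nu>)"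
proof -
  have "finite (sg_components H)" using assms by (simp add: sg_components_def signed_graph_def)
  then have "num_balanced H > 0 \<longleftrightarrow> (\<exists>C\<in>sg_components H. sg_balanced C)"
    by (auto simp: num_balanced_def card_gt_0_iff)
  then show ?thesis using ex_balanced_component_iff[OF assms] by simp
qed

text \<open>A nonempty positive part of a connected graph is everything, so by Harary's theorem it makes the
  graph balanced.\<close>

lemma connected_unbalanced_no_positive_part:
  assumes "signed_graph G" "sg_connected G" "\<not> sg_balanced G" "Y \<noteq> {}"
  shows "\<not> positive_part G Y \<nu>"
proof
  assume pos: "positive_part G Y \<nu>"
  then have "Y \<subseteq> sg_verts G" by (simp add: positive_part_def)
  moreover have "sg_verts G \<subseteq> Y"
    using positive_part_reachable[OF pos] assms(2,4) calculation unfolding sg_connected_def by blast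
  ultimately have "Y = sg_verts G" by blast
  then show False using pos assms(1,3) balanced_iff_positive_part by blast
qed

section \<open>Cuts\<close>

text \<open>The three constituents of \<open>\<delta>X\<^sup>\<nu>\<close> are the three ways in which an edge at \<open>X\<close> can violate the
  definition of a positive part: leaving \<open>X\<close>, being negative, having no second end. This lemma and the
  next one show that \<open>\<delta>X\<^sup>\<nu>\<close> is the least edge set whose deletion makes \<open>X\<close> with \<open>\<nu>\<close> a positive part.\<close>

lemma positive_part_delete_delta:
  assumes G: "signed_graph G" and X: "X \<subseteq> sg_verts G" and \<nu>: "switching_on G X \<nu>"
  shows "positive_part (sg_delete G (sg_delta G X \<nu>)) X \<nu>"
  unfolding positive_part_def
proof (intro conjI ballI allI impI)
  fix e i v assume "e \<in> sg_edges (sg_delete G (sg_delta G X \<nu>))" "v \<in> X"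
    "sg_attach (sg_delete G (sg_delta G X \<nu>)) e i = Some v"
  then have e: "e \<in> sg_edges G" "v \<in> X" "sg_attach G e i = Some v"
    and n: "e \<notin> cross_links G X" "e \<notin> neg_edges G X \<nu>" "e \<notin> outer_edges G X"
    by (auto simp: sg_delete_def sg_delta_def)
  have "sg_attach G e (\<not> i) \<noteq> None"
    using n(3) e by (auto simp: outer_edges_def outer_at_def)
  then obtain w where w: "sg_attach G e (\<not> i) = Some w" by blast
  have "w \<in> X"
    using n(1) e(1,2) joinsI[OF e(3) w] signed_graphD(1)[OF G e(1) w] by (auto simp: cross_links_def)
  have "sg_sign (sg_switch G \<nu>) e \<noteq> -1"
    using n(2) e(1,2) \<open>w \<in> X\<close> joinsI[OF e(3) w] by (auto simp: neg_edges_def sg_induced_def)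
  then have "\<nu> v * sg_sign G e * \<nu> w \<noteq> -1" using switch_sign[OF e(3) w] by simp
  moreover have "\<nu> v \<in> {1,-1}" "\<nu> w \<in> {1,-1}"
    using X \<nu> e(2) \<open>w \<in> X\<close> by (auto simp: switching_on_def)
  moreover have "sg_sign G e \<in> {1,-1}" using signed_graphD(2)[OF G e(1)] .
  ultimately have "\<nu> v * sg_sign G e * \<nu> w = 1" by auto
  then show "\<exists>w\<in>X. sg_attach (sg_delete G (sg_delta G X \<nu>)) e (\<not> i) = Some w \<and>
      \<nu> v * sg_sign (sg_delete G (sg_delta G X \<nu>)) e * \<nu> w = 1"
    using w \<open>w \<in> X\<close> by (auto simp: sg_delete_def)
qed (use X \<nu> in \<open>auto simp: switching_on_def sg_delete_def\<close>)

lemma delta_subset: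
  assumes pos: "positive_part (sg_delete G S) X \<nu>"
  shows "sg_delta G X \<nu> \<subseteq> S"
proof
  fix e assume e: "e \<in> sg_delta G X \<nu>"
  show "e \<in> S"
  proof (rule ccontr)
    assume "e \<notin> S"
    have eG: "e \<in> sg_edges G"
      using e by (auto simp: sg_delta_def cross_links_def neg_edges_def outer_edges_def sg_induced_def)
    with \<open>e \<notin> S\<close> have eS: "e \<in> sg_edges (sg_delete G S)" by (simp add: sg_delete_def)
    have att: "sg_attach (sg_delete G S) = sg_attach G" "sg_sign (sg_delete G S) = sg_sign G"
      by (auto simp: sg_delete_def)
    have j: "joins (sg_delete G S) e u v \<longleftrightarrow> joins G e u v" for u v by (simp add: joins_def att)
    from e consider "e \<in> cross_links G X" | "e \<in> neg_edges G X \<nu>" | "e \<in> outer_edges G X"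
      by (auto simp: sg_delta_def)
    then show False
    proof cases
      case 1
      then show False using positive_part_joins(1)[OF pos eS] j by (auto simp: cross_links_def)
    next
      case 2
      then obtain u v where "u \<in> X" "joins G e u v" "sg_sign (sg_switch G \<nu>) e = -1"
        by (auto simp: neg_edges_def sg_induced_def)
      then show False
        using positive_part_joins(2)[OF pos eS] switch_sign_joins[of G e u v \<nu>] j att by simp
    next
      case 3
      then obtain i v where "v \<in> X" "sg_attach G e i = Some v" "sg_attach G e (\<not> i) = None"
        by (auto simp: outer_edges_def outer_at_def)
      then show False using positive_partD[OF pos eS, of i v] att by auto
    qed
  qed
qed

lemma induced_inter_delta: "sg_edges (sg_induced G X) \<inter> sg_delta G X \<nu> = neg_edges G X \<nu>"
proof -
  have "neg_edges G X \<nu> \<subseteq> sg_edges (sg_induced G X) \<inter> sg_delta G X \<nu>"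
    by (auto simp: sg_delta_def neg_edges_def)
  moreover have "e \<notin> cross_links G X \<and> e \<notin> outer_edges G X"
    if "e \<in> sg_edges (sg_induced G X)" for e
    using that by (auto simp: sg_induced_def cross_links_def outer_edges_def outer_at_def
        joins_def ex_bool_eq)
  ultimately show ?thesis by (auto simp: sg_delta_def)
qed

lemma positive_part_induced_delete:
  assumes "positive_part (sg_delete G S) X \<nu>"
  shows "positive_part (sg_delete (sg_induced G X) S) X \<nu>"
  using assms
  by (rule positive_part_mono) (auto simp: sg_delete_def sg_induced_def)

text \<open>The balance conditions in the definition of a cut turn into connectivity. The graph
  \<open>\<Sigma>[X] \<setminus> U\<close> is balanced by its very construction. Adding back a negative edge \<open>e\<close> keeps it balanced
  if the ends of \<open>e\<close> lie in different components (reverse the switching on one of them). If they lie in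
  the same component, the switching is determined there up to a global sign, so \<open>e\<close> stays negative for
  every switching that makes the other edges positive.\<close>

lemma cut_via_iff:
  assumes G: "signed_graph G"
  shows "sg_cut_via G X \<nu> U \<longleftrightarrow>
    X \<noteq> {} \<and> X \<subseteq> sg_verts G \<and> switching_on G X \<nu> \<and> U = sg_delta G X \<nu> \<and> U \<noteq> {} \<and>
    (\<forall>e\<in>neg_edges G X \<nu>. \<forall>u v. joins G e u v \<longrightarrow> (sg_adj (sg_delete (sg_induced G X) U))\<^sup>*\<^sup>* u v)"
    (is "?cut \<longleftrightarrow> _ \<and> _ \<and> _ \<and> _ \<and> _ \<and> ?conn")
proof -
  let ?K = "sg_delete (sg_induced G X) U"
  have equiv: "?cut \<longleftrightarrow> ?conn" if X: "X \<noteq> {}" "X \<subseteq> sg_verts G" and \<nu>: "switching_on G X \<nu>"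
    and U: "U = sg_delta G X \<nu>" "U \<noteq> {}"
  proof -
    let ?I = "sg_edges (sg_induced G X)"
    have Ksg: "signed_graph ?K"
      using signed_graph_delete[OF signed_graph_induced[OF G X(2)]] .
    have KX: "sg_verts ?K = X" "sg_attach ?K = sg_attach G" "sg_sign ?K = sg_sign G"
      by (auto simp: sg_delete_def sg_induced_def)
    have Kpos: "positive_part ?K X \<nu>"
      using positive_part_induced_delete positive_part_delete_delta[OF G X(2) \<nu>] U(1) by simp
    then have Kbal: "sg_balanced ?K" using balanced_iff_positive_part[OF Ksg] KX(1) by auto
    have inU: "?I \<inter> U = neg_edges G X \<nu>" using U(1) induced_inter_delta by simp
    have neg: "\<forall>e\<in>?I \<inter> U. sg_sign (sg_switch G \<nu>) e = -1"
      unfolding inU by (simp add: neg_edges_def)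
    have pos: "\<forall>e\<in>?I - U. sg_sign (sg_switch G \<nu>) e = 1"
    proof
      fix e assume e: "e \<in> ?I - U"
      then obtain u v where uv: "u \<in> X" "joins G e u v" by (auto simp: sg_induced_def)
      then show "sg_sign (sg_switch G \<nu>) e = 1"
        using positive_part_joins(2)[OF Kpos, of e u v] e switch_sign_joins[of G e u v \<nu>]
        by simp
    qed
    have unb: "sg_balanced (sg_delete (sg_induced G X) (U - {e})) \<longleftrightarrow>
        \<not> (\<forall>u v. joins G e u v \<longrightarrow> (sg_adj ?K)\<^sup>*\<^sup>* u v)" if e: "e \<in> neg_edges G X \<nu>" for e
    proof -
      let ?L = "sg_delete (sg_induced G X) (U - {e})"
      have eI: "e \<in> ?I" "e \<in> U" using e inU by auto
      have L: "?L = ?K\<lparr>sg_edges := insert e (sg_edges ?K)\<rparr>"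
      proof -
        have "?I - (U - {e}) = insert e (?I - U)" using eI by auto
        then show ?thesis by (simp add: sg_delete_def)
      qed
      have Lsg: "signed_graph ?L"
        using signed_graph_delete[OF signed_graph_induced[OF G X(2)]] .
      have LX: "sg_verts ?L = X" "sg_attach ?L = sg_attach G" "sg_sign ?L = sg_sign G"
        by (auto simp: sg_delete_def sg_induced_def)
      have eG: "e \<in> sg_edges G" using eI by (simp add: sg_induced_def)
      have endX: "u \<in> X \<and> v \<in> X" if "joins G e u v" for u v
        using that eI(1) by (auto simp: sg_induced_def joins_def ex_bool_eq)
      show ?thesis
      proof
        assume "sg_balanced ?L"
        then obtain \<mu> where \<mu>: "positive_part ?L X \<mu>"
          using balanced_iff_positive_part[OF Lsg] LX(1) by auto
        show "\<not> (\<forall>u v. joins G e u v \<longrightarrow> (sg_adj ?K)\<^sup>*\<^sup>* u v)"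
        proof
          assume c: "\<forall>u v. joins G e u v \<longrightarrow> (sg_adj ?K)\<^sup>*\<^sup>* u v"
          obtain u v where uv: "joins G e u v" using eI(1) by (auto simp: sg_induced_def)
          have \<mu>K: "positive_part ?K X \<mu>"
            by (rule positive_part_mono[OF \<mu>]) (auto simp: sg_delete_def sg_induced_def)
          \<comment> \<open>Along edges of \<open>\<Sigma>[X] \<setminus> U\<close> both \<open>\<nu>\<close> and \<open>\<mu>\<close> reproduce the sign, hence they agree up to a global sign.\<close>
          have eq: "y \<in> X \<and> \<nu> u * \<nu> y = \<mu> u * \<mu> y" if "(sg_adj ?K)\<^sup>*\<^sup>* u y" for y
            using that
          proof induction
            case base
            have "\<nu> u \<in> {1,-1}" "\<mu> u \<in> {1,-1}"
              using Kpos \<mu>K endX[OF uv] by (auto simp: positive_part_def)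
            then show ?case using endX[OF uv] by auto
          next
            case (step y z)
            then obtain d where d: "d \<in> sg_edges ?K" "joins ?K d y z" by (auto simp: sg_adj_def)
            note p = positive_part_joins[OF Kpos d] positive_part_joins[OF \<mu>K d]
            have z: "z \<in> X" using p step.IH by blast
            have "\<nu> x \<in> {1,-1}" "\<mu> x \<in> {1,-1}" if "x \<in> X" for x
              using Kpos \<mu>K that by (auto simp: positive_part_def)
            note pm = this[of u] this[of y] this[of z]
            show ?case using p step.IH z pm endX[OF uv] by auto
          qed
          have "\<nu> u * \<nu> v = \<mu> u * \<mu> v" using eq c uv by blast
          moreover have "\<mu> u * sg_sign ?L e * \<mu> v = 1"
            by (rule positive_part_joins(2)[OF \<mu>])
              (use eI uv endX[OF uv] in \<open>auto simp: sg_delete_def sg_induced_def joins_def\<close>)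
          moreover have "\<nu> u * sg_sign G e * \<nu> v = -1"
            using e switch_sign_joins[OF uv, of \<nu>] by (simp add: neg_edges_def)
          ultimately show False
            using LX(3) by (metis mult.assoc mult.commute one_neq_neg_one)
        qed
      next
        assume "\<not> (\<forall>u v. joins G e u v \<longrightarrow> (sg_adj ?K)\<^sup>*\<^sup>* u v)"
        then obtain u v i where uv: "sg_attach G e i = Some u" "sg_attach G e (\<not> i) = Some v"
          "\<not> (sg_adj ?K)\<^sup>*\<^sup>* u v" by (auto simp: joins_def)
        have "\<exists>\<mu>. positive_part ?L X \<mu>"
          using positive_part_extend[of ?K \<nu> e i u v] Kpos uv endX[OF joinsI[OF uv(1,2)]]
            signed_graphD(2)[OF G eG] L KX by simp
        then show "sg_balanced ?L" using balanced_iff_positive_part[OF Lsg] LX(1) by simp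
      qed
    qed
    have "?cut \<longleftrightarrow> (\<forall>e\<in>?I \<inter> U. \<not> sg_balanced (sg_delete (sg_induced G X) (U - {e})))"
      unfolding sg_cut_via_def using X \<nu> U Kbal neg pos by simp
    also have "\<dots> \<longleftrightarrow> ?conn" unfolding inU using unb by simp
    finally show ?thesis .
  qed
  have "X \<noteq> {} \<and> X \<subseteq> sg_verts G \<and> switching_on G X \<nu> \<and> U = sg_delta G X \<nu> \<and> U \<noteq> {}" if ?cut
    using that unfolding sg_cut_via_def by blast
  then show ?thesis using equiv by argo
qed


lemma cut_via_positive_part:
  assumes "signed_graph G" "sg_cut_via G X \<nu> U"
  shows "positive_part (sg_delete G U) X \<nu>"
  using positive_part_delete_delta[OF assms(1)] assms(2) by (simp add: sg_cut_via_def)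

text \<open>The cut is \<open>\<delta>X\<^sup>\<mu>\<close> for one component \<open>X\<close> of \<open>\<Sigma> \<setminus> S\<close> inside the positive part \<open>Y\<close>. Passing from \<open>Y\<close>
  to a component is essential: it supplies the connectivity demanded by \<open>cut_via_iff\<close>. The cut is
  nonempty because otherwise \<open>X\<close> would be a positive part of \<open>\<Sigma>\<close> itself.\<close>

lemma ex_cut_subset:
  assumes G: "signed_graph G" "sg_connected G" "\<not> sg_balanced G"
    and Y: "Y \<noteq> {}" "positive_part (sg_delete G S) Y \<nu>"
  shows "\<exists>U\<subseteq>S. sg_cut G U"
proof -
  let ?H = "sg_delete G S"
  obtain v where v: "v \<in> Y" using Y(1) by blast
  define X where "X = component_verts ?H v"
  \<comment> \<open>A switching on \<open>X\<close> must take the value 1 outside \<open>X\<close>.\<close>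
  define \<mu> where "\<mu> x = (if x \<in> X then \<nu> x else 1)" for x
  have "v \<in> sg_verts ?H" using v Y(2) by (auto simp: positive_part_def)
  then have vX: "v \<in> X" by (simp add: X_def component_verts_def)
  have X\<nu>: "positive_part ?H X \<nu>"
    using positive_part_component[OF Y(2) v] by (simp add: X_def component_verts_def)
  then have pos: "positive_part ?H X \<mu>" by (auto simp: positive_part_def \<mu>_def)
  define U where "U = sg_delta G X \<mu>"
  have US: "U \<subseteq> S" unfolding U_def using delta_subset[OF pos] .
  have XV: "X \<subseteq> sg_verts G" using pos by (simp add: positive_part_def)
  have sw: "switching_on G X \<mu>" using X\<nu> by (auto simp: switching_on_def positive_part_def \<mu>_def)
  have "U \<noteq> {}"
  proof
    assume "U = {}"
    then have "positive_part (sg_delete G {}) X \<mu>"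
      using positive_part_delete_delta[OF G(1) XV sw] by (simp add: U_def)
    then have "positive_part G X \<mu>" by (rule positive_part_mono) (auto simp: XV)
    then show False using connected_unbalanced_no_positive_part[OF G] vX by blast
  qed
  moreover have "(sg_adj (sg_delete (sg_induced G X) U))\<^sup>*\<^sup>* x y"
    if x: "x \<in> X" and y: "y \<in> X" for x y
  proof -
    have "(sg_adj ?H)\<^sup>*\<^sup>* v x" "(sg_adj ?H)\<^sup>*\<^sup>* v y"
      using x y by (simp_all add: X_def component_verts_def)
    then have "(sg_adj ?H)\<^sup>*\<^sup>* x y" using rtranclp_trans[OF reachable_sym] by fast
    then have "y \<in> X \<and> (sg_adj (sg_delete (sg_induced G X) U))\<^sup>*\<^sup>* x y"
    proof induction
      case (step y z)
      then obtain e where e: "e \<in> sg_edges ?H" "joins ?H e y z" by (auto simp: sg_adj_def)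
      have "z \<in> X" using positive_part_joins(1)[OF pos e] step.IH by blast
      then have "e \<in> sg_edges (sg_delete (sg_induced G X) U)"
        using e step.IH US by (auto simp: sg_induced_def)
      then have "sg_adj (sg_delete (sg_induced G X) U) y z" using e by (auto simp: sg_adj_def)
      then show ?case using step.IH \<open>z \<in> X\<close> by (auto intro: rtranclp.rtrancl_into_rtrancl)
    qed (use x in simp)
    then show ?thesis by blast
  qed
  moreover have "u \<in> X \<and> w \<in> X" if "e \<in> neg_edges G X \<mu>" "joins G e u w" for e u w
    using that by (auto simp: neg_edges_def sg_induced_def joins_def ex_bool_eq)
  ultimately have "sg_cut_via G X \<mu> U"
    unfolding cut_via_iff[OF G(1)] using vX XV sw U_def by blast
  then show ?thesis using US by (auto simp: sg_cut_def)
qed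

text \<open>Deleting more edges preserves positive parts, so a cut inside \<open>S\<close> leaves one in \<open>\<Sigma> \<setminus> S\<close>; the converse
  is \<open>ex_cut_subset\<close>.\<close>

lemma contains_cut_iff:
  assumes G: "signed_graph G" "sg_connected G" "\<not> sg_balanced G"
  shows "(\<exists>U\<subseteq>S. sg_cut G U) \<longleftrightarrow> num_balanced (sg_delete G S) > 0"
proof
  assume "\<exists>U\<subseteq>S. sg_cut G U"
  then obtain U X \<nu> where U: "U \<subseteq> S" "sg_cut_via G X \<nu> U" unfolding sg_cut_def by blast
  have "positive_part (sg_delete G S) X \<nu>"
    using cut_via_positive_part[OF G(1) U(2)]
    by (rule positive_part_mono) (use U in \<open>auto simp: sg_cut_via_def\<close>)
  moreover have "X \<noteq> {}" using U(2) by (simp add: sg_cut_via_def)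
  ultimately show "num_balanced (sg_delete G S) > 0"
    using num_balanced_pos_iff[OF signed_graph_delete[OF G(1)]] by blast
next
  assume "num_balanced (sg_delete G S) > 0"
  then obtain Y \<nu> where "Y \<noteq> {}" "positive_part (sg_delete G S) Y \<nu>"
    using num_balanced_pos_iff[OF signed_graph_delete[OF G(1)]] by blast
  then show "\<exists>U\<subseteq>S. sg_cut G U" by (rule ex_cut_subset[OF G])
qed

section \<open>Bonds\<close>

text \<open>A minimal cut is the same as a minimal set containing a cut, and for such sets removing single
  edges suffices to test minimality, because every superset of a set containing a cut contains a cut.\<close>

lemma bond_iff_minimal:
  assumes G: "signed_graph G" "sg_connected G" "\<not> sg_balanced G"
  shows "sg_bond G U \<longleftrightarrow> num_balanced (sg_delete G U) > 0 \<and>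
    (\<forall>e\<in>U. num_balanced (sg_delete G (U - {e})) = 0)"
proof -
  have "sg_bond G U \<longleftrightarrow> (\<exists>U'\<subseteq>U. sg_cut G U') \<and> (\<forall>e\<in>U. \<not> (\<exists>U'\<subseteq>U - {e}. sg_cut G U'))"
    (is "_ \<longleftrightarrow> ?ex \<and> ?min")
  proof
    assume "sg_bond G U"
    then show "?ex \<and> ?min" unfolding sg_bond_def by blast
  next
    assume A: "?ex \<and> ?min"
    have "U' = U" if "U' \<subseteq> U" "sg_cut G U'" for U' using A that by blast
    then show "sg_bond G U" using A unfolding sg_bond_def by blast
  qed
  then show ?thesis unfolding contains_cut_iff[OF G] by simp
qed

lemma bond_minimalD:
  assumes G: "signed_graph G" "sg_connected G" "\<not> sg_balanced G"
    and U: "sg_bond G U" "e \<in> U" and Y: "positive_part (sg_delete G (U - {e})) Y \<mu>"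
  shows "Y = {}"
proof (rule ccontr)
  assume "Y \<noteq> {}"
  with Y have "num_balanced (sg_delete G (U - {e})) > 0"
    using num_balanced_pos_iff[OF signed_graph_delete[OF G(1)]] by blast
  then show False using U bond_iff_minimal[OF G] by simp
qed

lemma boundary_edge:
  assumes "positive_part (sg_delete G U) Y \<nu>" "\<not> positive_part G Y \<nu>"
  obtains e i v where "e \<in> sg_edges G" "e \<in> U" "v \<in> Y" "sg_attach G e i = Some v"
proof -
  have "\<not> (\<forall>e\<in>sg_edges G. \<forall>i. \<forall>v\<in>Y. sg_attach G e i = Some v \<longrightarrow>
        (\<exists>w\<in>Y. sg_attach G e (\<not> i) = Some w \<and> \<nu> v * sg_sign G e * \<nu> w = 1))"
    using assms by (auto simp: positive_part_def)
  then obtain e i v where e: "e \<in> sg_edges G" "v \<in> Y" "sg_attach G e i = Some v"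
    "\<not> (\<exists>w\<in>Y. sg_attach G e (\<not> i) = Some w \<and> \<nu> v * sg_sign G e * \<nu> w = 1)" by blast
  have "e \<in> U"
  proof (rule ccontr)
    assume "e \<notin> U"
    then show False using positive_partD[OF assms(1), of e i v] e by auto
  qed
  then show thesis using that e by blast
qed

text \<open>Otherwise split \<open>X\<close> into two positive parts of \<open>\<Sigma> \<setminus> U\<close> with no edge of \<open>\<Sigma>\<close> between them. As \<open>\<Sigma>\<close> is
  connected and unbalanced, some edge \<open>e\<close> of \<open>U\<close> has an end in the first part. It has no end in the
  second, so restoring \<open>e\<close> leaves the second part positive, against minimality.\<close>

lemma bond_imp_connected:
  assumes G: "signed_graph G" "sg_connected G" "\<not> sg_balanced G"
    and cut: "sg_cut_via G X \<nu> U" and bond: "sg_bond G U"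
  shows "sg_connected (sg_induced G X)"
proof (rule ccontr)
  let ?I = "sg_induced G X"
  have X: "X \<noteq> {}" using cut by (simp add: sg_cut_via_def)
  have pos: "positive_part (sg_delete G U) X \<nu>" using cut_via_positive_part[OF G(1) cut] .
  assume "\<not> sg_connected ?I"
  then obtain u w where uw: "u \<in> X" "w \<in> X" "\<not> (sg_adj ?I)\<^sup>*\<^sup>* u w"
    using X by (auto simp: sg_connected_def)
  define Z where "Z = {x. (sg_adj ?I)\<^sup>*\<^sup>* u x}"
  have Z: "x \<in> Z \<longleftrightarrow> y \<in> Z" if "e \<in> sg_edges G" "joins G e x y" "x \<in> X" "y \<in> X" for e x y
  proof -
    have "sg_adj ?I x y" using that by (auto simp: sg_adj_def sg_induced_def joins_def)
    then show ?thesis using reachable_adj_iff by (simp add: Z_def)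
  qed
  have Z': "x \<in> Z \<longleftrightarrow> y \<in> Z" if "e \<in> sg_edges (sg_delete G U)" "joins (sg_delete G U) e x y" "x \<in> X"
    for e x y
    using Z[of e x y] that positive_part_joins(1)[OF pos that] by simp
  have pos1: "positive_part (sg_delete G U) (X \<inter> Z) \<nu>"
    by (rule positive_part_Int[OF pos]) (rule Z')
  have pos2: "positive_part (sg_delete G U) (X \<inter> - Z) \<nu>"
    by (rule positive_part_Int[OF pos]) (use Z' in blast)
  have "u \<in> X \<inter> Z" using uw by (simp add: Z_def)
  then have "X \<inter> Z \<noteq> {}" by blast
  then have "\<not> positive_part G (X \<inter> Z) \<nu>" by (rule connected_unbalanced_no_positive_part[OF G])
  then obtain e i v where e: "e \<in> sg_edges G" "e \<in> U" "v \<in> X \<inter> Z" "sg_attach G e i = Some v"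
    by (rule boundary_edge[OF pos1])
  have no: "sg_attach G e j \<noteq> Some y" if y: "y \<in> X \<inter> - Z" for j y
  proof
    assume j: "sg_attach G e j = Some y"
    have "j \<noteq> i"
    proof
      assume "j = i"
      then have "y = v" using j e(4) by simp
      then show False using y e(3) by blast
    qed
    then have "(\<not> i) = j" by blast
    then have "joins G e v y" using joinsI[OF e(4), of y] j by simp
    then show False using Z[OF e(1), of v y] y e(3) by blast
  qed
  have "positive_part (sg_delete G (U - {e})) (X \<inter> - Z) \<nu>"
    unfolding positive_part_def
  proof (intro conjI ballI allI impI)
    fix d j y assume d: "d \<in> sg_edges (sg_delete G (U - {e}))" "y \<in> X \<inter> - Z"
      "sg_attach (sg_delete G (U - {e})) d j = Some y"
    then have "d \<noteq> e" using no by auto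
    with d show "\<exists>w\<in>X \<inter> - Z. sg_attach (sg_delete G (U - {e})) d (\<not> j) = Some w \<and>
        \<nu> y * sg_sign (sg_delete G (U - {e})) d * \<nu> w = 1"
      using positive_partD[OF pos2, of d j y] by auto
  qed (use pos2 in \<open>auto simp: positive_part_def\<close>)
  then have "X \<inter> - Z = {}" by (rule bond_minimalD[OF G bond e(2)])
  moreover have "w \<in> X \<inter> - Z" using uw by (simp add: Z_def)
  ultimately show False by blast
qed

text \<open>A balanced component of \<open>\<Sigma>[X\<^sup>c)\<close> with vertex set \<open>Y\<close> must be linked to \<open>X\<close> by some edge \<open>e\<close> of \<open>U\<close>,
  since \<open>\<Sigma>\<close> is connected and unbalanced. Reversing the switching of \<open>Y\<close> if necessary makes \<open>e\<close>
  positive, and then \<open>X \<union> Y\<close> is a positive part after restoring \<open>e\<close>, against minimality.\<close>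

lemma bond_imp_unbalanced:
  assumes G: "signed_graph G" "sg_connected G" "\<not> sg_balanced G"
    and cut: "sg_cut_via G X \<nu> U" and bond: "sg_bond G U"
    and C: "C \<in> sg_components (sg_induced_outer G (sg_verts G - X))"
  shows "\<not> sg_balanced C"
proof
  let ?V = "sg_verts G"
  let ?J = "sg_induced_outer G (?V - X)"
  assume "sg_balanced C"
  moreover have Jsg: "signed_graph ?J" using signed_graph_induced_outer[OF G(1)] by blast
  ultimately obtain Y \<mu> where Y: "Y \<noteq> {}" "positive_part ?J Y \<mu>"
    using ex_balanced_component_iff[OF Jsg] C by blast
  have J: "sg_verts ?J = ?V - X" "sg_attach ?J = sg_attach G" "sg_sign ?J = sg_sign G"
    by (auto simp: sg_induced_outer_def)
  have YV: "Y \<subseteq> ?V - X" using Y(2) J by (simp add: positive_part_def)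
  have pos: "positive_part (sg_delete G U) X \<nu>" using cut_via_positive_part[OF G(1) cut] .
  have XV: "X \<subseteq> ?V" and U: "U = sg_delta G X \<nu>" using cut by (auto simp: sg_cut_via_def)
  have val: "\<And>x. x \<in> X \<Longrightarrow> \<nu> x \<in> {1, -1}" "\<And>x. x \<in> Y \<Longrightarrow> \<mu> x \<in> {1, -1}"
    using pos Y(2) by (auto simp: positive_part_def)
  have "\<not> positive_part G Y \<mu>" using connected_unbalanced_no_positive_part[OF G Y(1)] .
  then have "\<not> (\<forall>e\<in>sg_edges G. \<forall>i. \<forall>v\<in>Y. sg_attach G e i = Some v \<longrightarrow>
        (\<exists>w\<in>Y. sg_attach G e (\<not> i) = Some w \<and> \<mu> v * sg_sign G e * \<mu> w = 1))"
    using Y(2) YV by (auto simp: positive_part_def)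
  then obtain e i y where e: "e \<in> sg_edges G" "y \<in> Y" "sg_attach G e i = Some y"
    "\<not> (\<exists>w\<in>Y. sg_attach G e (\<not> i) = Some w \<and> \<mu> y * sg_sign G e * \<mu> w = 1)" by blast
  have "e \<notin> sg_edges ?J"
    using positive_partD[OF Y(2), of e i y] e J by auto
  then obtain x where x: "sg_attach G e (\<not> i) = Some x" "x \<notin> ?V - X"
    using induced_outer_edgeI[OF e(1,3), of "?V - X"] e(2) YV by blast
  then have xX: "x \<in> X" using signed_graphD(1)[OF G(1) e(1)] by blast
  have "joins G e x y" using joins_sym[OF joinsI[OF e(3) x(1)]] .
  then have eU: "e \<in> U" using e(1,2) xX YV by (auto simp: U sg_delta_def cross_links_def)
  \<comment> \<open>The factor \<open>t\<close> is the sign of \<open>e\<close> under the two given switchings; multiplying \<open>\<mu>\<close> by it makes \<open>e\<close> positive.\<close>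
  define t where "t = \<nu> x * sg_sign G e * \<mu> y"
  have t: "t \<in> {1, -1}"
    using val(1)[OF xX] val(2)[OF e(2)] signed_graphD(2)[OF G(1) e(1)] by (auto simp: t_def)
  define \<rho> where "\<rho> z = (if z \<in> X then \<nu> z else t * \<mu> z)" for z
  have \<rho>Y: "\<rho> z = t * \<mu> z" if "z \<in> Y" for z using that YV by (auto simp: \<rho>_def)
  have tt: "t * t = 1" using t by auto
  have "positive_part (sg_delete G (U - {e})) (X \<union> Y) \<rho>"
    unfolding positive_part_def
  proof (intro conjI ballI allI impI)
    show "X \<union> Y \<subseteq> sg_verts (sg_delete G (U - {e}))" using XV YV by auto
    show "\<rho> z \<in> {1, -1}" if "z \<in> X \<union> Y" for z
      using that val t \<rho>Y by (fastforce simp: \<rho>_def)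
    fix d j z assume "d \<in> sg_edges (sg_delete G (U - {e}))" "z \<in> X \<union> Y"
      "sg_attach (sg_delete G (U - {e})) d j = Some z"
    then have d: "d \<in> sg_edges G" "d = e \<or> d \<notin> U" "z \<in> X \<union> Y" "sg_attach G d j = Some z" by auto
    have "\<exists>w\<in>X \<union> Y. sg_attach G d (\<not> j) = Some w \<and> \<rho> z * sg_sign G d * \<rho> w = 1"
    proof (cases "d = e")
      case True
      have "\<rho> x * sg_sign G e * \<rho> y = 1"
        using \<rho>Y[OF e(2)] xX tt by (simp add: \<rho>_def t_def mult_ac)
      then show ?thesis using True d(4) e(2,3) x(1) xX by (cases "j = i") (auto simp: mult_ac)
    next
      case False
      then have dU: "d \<notin> U" using d(2) by blast
      show ?thesis
      proof (cases "z \<in> X")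
        case True
        then obtain w where "w \<in> X" "sg_attach G d (\<not> j) = Some w" "\<nu> z * sg_sign G d * \<nu> w = 1"
          using positive_partD[OF pos, of d j z] d dU by auto
        then show ?thesis using True by (auto simp: \<rho>_def)
      next
        case False
        then have zY: "z \<in> Y" using d(3) by blast
        have "w \<in> ?V - X" if w: "sg_attach G d (\<not> j) = Some w" for w
        proof -
          have "joins G d w z" using joins_sym[OF joinsI[OF d(4) w]] .
          then have "w \<notin> X" using dU d(1) zY YV by (auto simp: U sg_delta_def cross_links_def)
          then show ?thesis using signed_graphD(1)[OF G(1) d(1) w] by blast
        qed
        then have "d \<in> sg_edges ?J" using induced_outer_edgeI[OF d(1,4)] zY YV by blast
        then obtain w where w: "w \<in> Y" "sg_attach G d (\<not> j) = Some w" "\<mu> z * sg_sign G d * \<mu> w = 1"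
          using positive_partD[OF Y(2), of d j z] d(4) zY J by auto
        have "\<rho> z * sg_sign G d * \<rho> w = (t * t) * (\<mu> z * sg_sign G d * \<mu> w)"
          using \<rho>Y zY w(1) by (simp add: mult_ac)
        then show ?thesis using w tt by auto
      qed
    qed
    then show "\<exists>w\<in>X \<union> Y. sg_attach (sg_delete G (U - {e})) d (\<not> j) = Some w \<and>
        \<rho> z * sg_sign (sg_delete G (U - {e})) d * \<rho> w = 1" by simp
  qed
  then have "X \<union> Y = {}" by (rule bond_minimalD[OF G bond eU])
  then show False using Y(1) by blast
qed

text \<open>A positive part that avoids \<open>X\<close> would be a union of balanced components of \<open>\<Sigma>[X\<^sup>c)\<close>, so it is empty.
  A nonempty one therefore meets \<open>X\<close> and contains all of it, because in a cut the negative edges join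
  vertices already connected in \<open>\<Sigma>[X] \<setminus> U\<close>, so that \<open>X\<close> remains connected in \<open>\<Sigma> \<setminus> U\<close>. What lies
  outside \<open>X\<close> is again a positive part avoiding \<open>X\<close>.\<close>

lemma unique_positive_part:
  assumes G: "signed_graph G" and cut: "sg_cut_via G X \<nu> U"
    and conn: "sg_connected (sg_induced G X)"
    and unb: "\<forall>C\<in>sg_components (sg_induced_outer G (sg_verts G - X)). \<not> sg_balanced C"
    and Y: "Y \<noteq> {}" "positive_part (sg_delete G U) Y \<mu>"
  shows "Y = X"
proof -
  let ?V = "sg_verts G"
  let ?J = "sg_induced_outer G (?V - X)"
  let ?H = "sg_delete G U"
  have pos: "positive_part ?H X \<nu>" using cut_via_positive_part[OF G cut] .
  have U: "U = sg_delta G X \<nu>" using cut by (simp add: sg_cut_via_def)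
  have disj: "Z = {}" if Z: "positive_part ?H Z \<mu>" "Z \<inter> X = {}" for Z
  proof (rule ccontr)
    assume "Z \<noteq> {}"
    have "sg_edges ?J \<inter> sg_delta G X \<nu> = {}"
      by (auto simp: sg_induced_outer_def sg_induced_def sg_delta_def outer_edges_def outer_at_def
          cross_links_def neg_edges_def joins_def ex_bool_eq)
    moreover have "sg_edges ?J \<subseteq> sg_edges G"
      by (auto simp: sg_induced_outer_def sg_induced_def outer_edges_def)
    ultimately have "positive_part ?J Z \<mu>"
      by (intro positive_part_mono[OF Z(1)])
        (use Z in \<open>auto simp: U sg_induced_outer_def positive_part_def\<close>)
    moreover have "signed_graph ?J" using signed_graph_induced_outer[OF G] by blast
    ultimately show False using ex_balanced_component_iff unb \<open>Z \<noteq> {}\<close> by blast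
  qed
  have reach: "(sg_adj ?H)\<^sup>*\<^sup>* x y" if "x \<in> X" "y \<in> X" for x y
  proof -
    have "(sg_adj (sg_induced G X))\<^sup>*\<^sup>* x y" using conn that by (simp add: sg_connected_def)
    then show ?thesis
    proof induction
      case (step y z)
      then obtain e where e: "e \<in> sg_edges (sg_induced G X)" "joins G e y z"
        by (auto simp: sg_adj_def)
      have "(sg_adj ?H)\<^sup>*\<^sup>* y z"
      proof (cases "e \<in> U")
        case True
        then have "e \<in> neg_edges G X \<nu>" using e induced_inter_delta[of G X \<nu>] U by blast
        then have "(sg_adj (sg_delete (sg_induced G X) U))\<^sup>*\<^sup>* y z"
          using cut e(2) unfolding cut_via_iff[OF G] by blast
        then show ?thesis by (rule reachable_mono) (auto simp: sg_induced_def)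
      next
        case False
        then have "sg_adj ?H y z" using e by (auto simp: sg_adj_def sg_induced_def)
        then show ?thesis by blast
      qed
      then show ?case using step.IH by (rule rtranclp_trans[rotated])
    qed simp
  qed
  have "X \<subseteq> Y"
  proof -
    obtain x where "x \<in> Y" "x \<in> X" using disj[OF Y(2)] Y(1) by blast
    then show ?thesis using positive_part_reachable[OF Y(2) reach] by blast
  qed
  moreover have "Y \<inter> - X = {}"
  proof (rule disj)
    show "positive_part ?H (Y \<inter> - X) \<mu>"
    proof (rule positive_part_Int[OF Y(2)])
      fix e u v assume "e \<in> sg_edges ?H" "joins ?H e u v"
      then show "u \<in> - X \<longleftrightarrow> v \<in> - X"
        using positive_part_joins(1)[OF pos, of e u v] positive_part_joins(1)[OF pos, of e v u]
          joins_sym[of G e u v] by auto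
    qed
  qed blast
  ultimately show ?thesis by blast
qed

text \<open>A positive part that remains after restoring \<open>e\<close> is positive without \<open>e\<close>, so it is \<open>X\<close>. Hence \<open>e\<close>, having
  an end in \<open>X\<close>, is an edge of \<open>\<Sigma>[X]\<close>, and \<open>(\<Sigma>[X] \<setminus> U) \<union> e\<close> is balanced. That contradicts the
  definition of a cut.\<close>

lemma bond_criterion:
  assumes G: "signed_graph G" "sg_connected G" "\<not> sg_balanced G" and cut: "sg_cut_via G X \<nu> U"
    and conn: "sg_connected (sg_induced G X)"
    and unb: "\<forall>C\<in>sg_components (sg_induced_outer G (sg_verts G - X)). \<not> sg_balanced C"
  shows "sg_bond G U"
  unfolding bond_iff_minimal[OF G]
proof (intro conjI ballI)
  have "sg_cut G U" using cut unfolding sg_cut_def by blast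
  then show "num_balanced (sg_delete G U) > 0" using contains_cut_iff[OF G] by blast
  fix e assume e: "e \<in> U"
  show "num_balanced (sg_delete G (U - {e})) = 0"
  proof (rule ccontr)
    assume "num_balanced (sg_delete G (U - {e})) \<noteq> 0"
    then obtain Y \<mu> where Y: "Y \<noteq> {}" "positive_part (sg_delete G (U - {e})) Y \<mu>"
      using num_balanced_pos_iff[OF signed_graph_delete[OF G(1)]] by blast
    have U: "U = sg_delta G X \<nu>" and XV: "X \<subseteq> sg_verts G" using cut by (auto simp: sg_cut_via_def)
    have "positive_part (sg_delete G U) Y \<mu>"
      by (rule positive_part_mono[OF Y(2)]) (use Y in \<open>auto simp: positive_part_def\<close>)
    then have YX: "Y = X" using unique_positive_part[OF G(1) cut conn unb Y(1)] by blast
    let ?L = "sg_delete (sg_induced G X) (U - {e})"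
    have "positive_part ?L X \<mu>" using positive_part_induced_delete Y(2) YX by blast
    then have "sg_balanced ?L"
      using balanced_iff_positive_part[OF signed_graph_delete[OF signed_graph_induced[OF G(1) XV]]] by auto
    moreover have "e \<in> sg_edges (sg_induced G X)"
    proof -
      have "e \<in> sg_edges G" using e
        by (auto simp: U sg_delta_def cross_links_def neg_edges_def outer_edges_def sg_induced_def)
      moreover obtain i u where u: "u \<in> X" "sg_attach G e i = Some u"
        using e by (auto simp: U sg_delta_def cross_links_def neg_edges_def outer_edges_def
            sg_induced_def joins_def outer_at_def)
      ultimately obtain v where "v \<in> X" "sg_attach G e (\<not> i) = Some v"
        using positive_partD[OF Y(2), of e i u] YX by auto
      then show ?thesis using \<open>e \<in> sg_edges G\<close> u joinsI[OF u(2)] by (auto simp: sg_induced_def)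
    qed
    ultimately show False using cut e unfolding sg_cut_via_def by blast
  qed
qed

lemma num_balanced_delete_bond:
  assumes G: "signed_graph G" and cut: "sg_cut_via G X \<nu> U"
    and conn: "sg_connected (sg_induced G X)"
    and unb: "\<forall>C\<in>sg_components (sg_induced_outer G (sg_verts G - X)). \<not> sg_balanced C"
  shows "num_balanced (sg_delete G U) = 1"
proof -
  let ?H = "sg_delete G U"
  have H: "signed_graph ?H" using signed_graph_delete[OF G] .
  note uniq = unique_positive_part[OF G cut conn unb]
  have "C = sg_induced_outer ?H X" if C: "C \<in> sg_components ?H" "sg_balanced C" for C
  proof -
    obtain v where v: "v \<in> sg_verts ?H" "C = sg_induced_outer ?H (component_verts ?H v)"
      using C(1) unfolding sg_components_eq by blast
    then obtain \<mu> where "positive_part ?H (component_verts ?H v) \<mu>"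
      using C(2) component_balanced_iff[OF H] by blast
    moreover have "v \<in> component_verts ?H v" using v(1) by (simp add: component_verts_def)
    ultimately show ?thesis using uniq v(2) by blast
  qed
  moreover have "\<exists>C\<in>sg_components ?H. sg_balanced C"
    unfolding ex_balanced_component_iff[OF H]
    using cut_via_positive_part[OF G cut] cut by (auto simp: sg_cut_via_def)
  ultimately have "{C \<in> sg_components ?H. sg_balanced C} = {sg_induced_outer ?H X}" by blast
  then show ?thesis by (simp add: num_balanced_def)
qed

theorem theorem4p4:
  fixes G :: "('v, 'e) sgraph" and X :: "'v set" and \<nu> :: "'v \<Rightarrow> int" and U :: "'e set"
  assumes "signed_graph G" and "sg_connected G" and "\<not> sg_balanced G"
    and "sg_cut_via G X \<nu> U"
  shows "num_balanced (sg_delete G U) > num_balanced G \<and>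
    (sg_bond G U \<longleftrightarrow>
       sg_connected (sg_induced G X) \<and>
       (\<forall>C\<in>sg_components (sg_induced_outer G (sg_verts G - X)). \<not> sg_balanced C)) \<and>
    (\<forall>S\<subseteq>sg_edges G. sg_bond G S \<longleftrightarrow>
       num_balanced (sg_delete G S) = num_balanced G + 1 \<and>
       (\<forall>e\<in>S. num_balanced G = num_balanced (sg_delete G (S - {e}))))"
proof (intro conjI allI impI)
  note G = assms(1-3)
  have G0: "num_balanced G = 0"
    using num_balanced_pos_iff[OF G(1)] connected_unbalanced_no_positive_part[OF G] by blast
  have "sg_cut G U" using assms(4) unfolding sg_cut_def by blast
  then have "num_balanced (sg_delete G U) > 0" using contains_cut_iff[OF G] by blast
  then show "num_balanced (sg_delete G U) > num_balanced G" using G0 by simp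
  show "sg_bond G U \<longleftrightarrow>
       sg_connected (sg_induced G X) \<and>
       (\<forall>C\<in>sg_components (sg_induced_outer G (sg_verts G - X)). \<not> sg_balanced C)"
    using bond_imp_connected[OF G assms(4)] bond_imp_unbalanced[OF G assms(4)]
      bond_criterion[OF G assms(4)] by blast
  fix S
  have "num_balanced (sg_delete G S) = 1" if bond: "sg_bond G S"
  proof -
    obtain Y \<mu> where cut: "sg_cut_via G Y \<mu> S"
      using bond unfolding sg_bond_def sg_cut_def by blast
    show ?thesis
      using num_balanced_delete_bond[OF G(1) cut bond_imp_connected[OF G cut bond]]
        bond_imp_unbalanced[OF G cut bond] by blast
  qed
  then show "sg_bond G S \<longleftrightarrow>
       num_balanced (sg_delete G S) = num_balanced G + 1 \<and>
       (\<forall>e\<in>S. num_balanced G = num_balanced (sg_delete G (S - {e})))"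
    using bond_iff_minimal[OF G, of S] by (auto simp: G0)
qed

end
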